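(* The outcome of Non-Disconnecting Arc-Kayles can be determined in polynomial time on clique trees.
   Context: Non-Disconnecting Arc-Kayles is the two-player impartial game played on a connected finite simple graph in which the players alternate removing two adjacent vertices (and all incident edges), with the constraint that the remaining graph must be connected; the first player unable to move loses. A clique tree (block graph) is a connected graph in which every biconnected component (block) is a clique. *)

theory Defs
  imports "HOL-Computational_Algebra.Polynomial" "Graph_Theory.Kuratowski"
begin

section \<open>Clique trees\<close>

text \<open>
  Finite simple graphs are the symmetric, loop-free digraphs without parallel arcs of the locale
  \<^locale>\<open>graph\<close>. The library's notion of connectedness excludes the graph without vertices.
\<close>

definition cut_vertex :: "('a, 'b) pre_digraph \<Rightarrow> 'a \<Rightarrow> bool" where
  "cut_vertex G v \<longleftrightarrow> v \<in> verts G \<and> verts G \<noteq> {v}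
     \<and> \<not> Digraph_Component.connected (pre_digraph.del_vert G v)"

text \<open>As usual for block decompositions, a single vertex and a single edge count as biconnected.\<close>

definition biconnected :: "('a, 'b) pre_digraph \<Rightarrow> bool" where
  "biconnected G \<longleftrightarrow> graph G \<and> Digraph_Component.connected G \<and> (\<nexists>v. cut_vertex G v)"

definition block :: "('a, 'b) pre_digraph \<Rightarrow> ('a, 'b) pre_digraph \<Rightarrow> bool" where
  "block G B \<longleftrightarrow> pre_digraph.max_subgraph G biconnected B"

definition clique_tree :: "('a, 'b) pre_digraph \<Rightarrow> bool" where
  "clique_tree G \<longleftrightarrow> graph G \<and> Digraph_Component.connected G
     \<and> (\<forall>B. block G B \<longrightarrow> complete_digraph (card (verts B)) B)"


section \<open>Non-Disconnecting Arc-Kayles\<close>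

text \<open>The last two vertices of a graph may be removed: nothing is disconnected by doing so.\<close>

definition ndak_move :: "('a, 'b) pre_digraph \<Rightarrow> ('a, 'b) pre_digraph \<Rightarrow> bool" where
  "ndak_move G G' \<longleftrightarrow> (\<exists>u v. u \<rightarrow>\<^bsub>G\<^esub> v \<and> G' = G \<restriction> (verts G - {u, v}))
     \<and> (verts G' = {} \<or> Digraph_Component.connected G')"

text \<open>
  The player about to move in \<open>G\<close> wins if he has a move to some \<open>G'\<close> such that he wins again
  from every position \<open>G''\<close> that the opponent may leave him; in particular he wins if the opponent
  has no move in \<open>G'\<close>. In a finite graph every play is finite, so that the opponent wins
  precisely when this predicate fails.
\<close>

inductive first_player_wins :: "('a, 'b) pre_digraph \<Rightarrow> bool" where
  "ndak_move G G' \<Longrightarrow> (\<forall>G''. ndak_move G' G'' \<longrightarrow> first_player_wins G'')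
     \<Longrightarrow> first_player_wins G"


section \<open>Polynomial time\<close>

text \<open>
  The machine model is the random access machine of Cook and Reckhow, with natural number registers
  and truncated subtraction, reading a binary word bit by bit; \<open>Load\<close> and \<open>Store\<close> are the
  indirect addressing instructions. Every instruction costs one unit. As there is no multiplication,
  the bit length of a register grows by at most one per step (up to an additive constant depending on
  the program), and so polynomial time agrees with polynomial time on Turing machines.
\<close>

datatype instr =
    Const nat nat
  | Add nat nat nat
  | Sub nat nat nat
  | Load nat nat
  | Store nat nat
  | JumpPos nat nat
  | Read nat

text \<open>Program counter, registers, and the part of the input that has not been read yet.\<close>

type_synonym config = "nat \<times> (nat \<Rightarrow> nat) \<times> bool list"

fun exec :: "instr \<Rightarrow> config \<Rightarrow> config" where
  "exec (Const i c) (pc, R, w) = (Suc pc, R(i := c), w)"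
| "exec (Add i j k) (pc, R, w) = (Suc pc, R(i := R j + R k), w)"
| "exec (Sub i j k) (pc, R, w) = (Suc pc, R(i := R j - R k), w)"
| "exec (Load i j) (pc, R, w) = (Suc pc, R(i := R (R j)), w)"
| "exec (Store i j) (pc, R, w) = (Suc pc, R(R i := R j), w)"
| "exec (JumpPos j l) (pc, R, w) = (if R j > 0 then l else Suc pc, R, w)"
| "exec (Read i) (pc, R, []) = (Suc pc, R(i := 0), [])"
| "exec (Read i) (pc, R, b # w) = (Suc pc, R(i := of_bool b), w)"

fun step :: "instr list \<Rightarrow> config \<Rightarrow> config" where
  "step P (pc, R, w) = (if pc < length P then exec (P ! pc) (pc, R, w) else (pc, R, w))"

text \<open>
  \<open>P\<close> leaves its program text after at most \<open>T\<close> steps on input \<open>w\<close>, with answer \<open>b\<close> in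
  register 0.
\<close>

definition answers_within :: "instr list \<Rightarrow> bool list \<Rightarrow> nat \<Rightarrow> bool \<Rightarrow> bool" where
  "answers_within P w T b \<longleftrightarrow>
     (\<exists>t \<le> T. \<exists>pc R w'. (step P ^^ t) (0, (\<lambda>_. 0), w) = (pc, R, w')
        \<and> length P \<le> pc \<and> R 0 = of_bool b)"

text \<open>
  The property \<open>Q\<close> is decidable in polynomial time on the class \<open>A\<close> of instances, encoded as binary
  words by \<open>enc\<close>. As usual for problems restricted to a class, nothing is demanded of
  the program on words that do not encode a member of \<open>A\<close>.
\<close>

definition poly_time_decidable_on :: "'i set \<Rightarrow> ('i \<Rightarrow> bool list) \<Rightarrow> ('i \<Rightarrow> bool) \<Rightarrow> bool" where
  "poly_time_decidable_on A enc Q \<longleftrightarrow>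
     (\<exists>(P :: instr list) (p :: nat poly). \<forall>x \<in> A.
        answers_within P (enc x) (poly p (length (enc x))) (Q x))"

text \<open>
  A graph with vertices \<open>0, \<dots>, n - 1\<close> is encoded as \<open>1\<^sup>n 0\<close> followed by the \<open>n\<^sup>2\<close> entries of
  its adjacency matrix, row by row.
\<close>

definition graph_word :: "nat pair_pre_digraph \<Rightarrow> bool list" where
  "graph_word G = (let n = card (pverts G) in
     replicate n True @ [False] @ [(u, v) \<in> parcs G. u \<leftarrow> [0..<n], v \<leftarrow> [0..<n]])"

end

theory Submission
  imports Defs
begin

text \<open>
  In a clique tree every cycle spans a clique. Hence removing two adjacent vertices \<open>u\<close>, \<open>v\<close> leaves a
  connected graph if and only if the neighbours of \<open>{u, v}\<close> form a clique: two neighbours that are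
  joined outside \<open>{u, v}\<close> lie on a common cycle. This local condition is preserved when vertices
  disappear, so that disjoint legal moves commute, while two legal moves that share a vertex lead to
  isomorphic positions. By induction all moves from a position lead to positions with the same
  outcome, and therefore the first player wins if and only if some (equivalently, every) maximal play
  has odd length. Playing greedily until no legal move is left takes polynomial time.
\<close>

section \<open>The outcome is the parity of any maximal play\<close>

text \<open>The game is detached from graphs at once: \<open>legal\<close> and \<open>wins\<close>
  fix one relation \<open>E\<close> and let only the vertex set \<open>S\<close> shrink. Invariance
  of the outcome thus becomes a statement about symmetric irreflexive relations. The clique tree
  enters through \<open>cycles_are_cliques\<close>, stated for the initial graph: a cycle of a
  position is a cycle of the initial graph, so positions never have to be recognised as clique trees
  again. It yields that a connected remainder makes a move legal; the converse is a rerouting of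
  walks. A further obstacle is that the outcome must be computed by an explicit machine program. Its
  only jumps close loops; every decision inside a loop is arithmetic with truncated subtraction on
  0/1 values. The number of rounds therefore depends on the number \<open>n\<close> of vertices
  alone, and the dominant part consists of five nested loops of \<open>n\<close> rounds
  each.\<close>

definition legal :: "('a \<Rightarrow> 'a \<Rightarrow> bool) \<Rightarrow> 'a set \<Rightarrow> 'a \<Rightarrow> 'a \<Rightarrow> bool" where
  "legal E S u v \<longleftrightarrow> u \<in> S \<and> v \<in> S \<and> E u v \<and>
     (\<forall>x \<in> S - {u, v}. \<forall>y \<in> S - {u, v}.
        x \<noteq> y \<and> (E u x \<or> E v x) \<and> (E u y \<or> E v y) \<longrightarrow> E x y)"

text \<open>\<open>finite S\<close> is repeated inside the set because the bounded quantifier passes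
  its membership fact on to the recursive call, and termination needs finiteness and legality
  there.\<close>

function wins :: "('a \<Rightarrow> 'a \<Rightarrow> bool) \<Rightarrow> 'a set \<Rightarrow> bool" where
  "wins E S \<longleftrightarrow> finite S \<and> (\<exists>e \<in> {(u, v). finite S \<and> legal E S u v}. \<not> wins E (S - {fst e, snd e}))"
  by pat_completeness auto
termination
proof (relation "measure (\<lambda>(E, S). card S)", goal_cases)
  case (2 E S e)
  then have "finite S" "fst e \<in> S"
    unfolding legal_def by auto
  then have "card (S - {fst e, snd e}) < card S"
    by (metis DiffD2 Diff_subset insertI1 psubsetI psubset_card_mono)
  then show ?case
    by simp
qed simp

declare wins.simps [simp del]

lemma wins_iff:
  assumes "finite S"
  shows "wins E S \<longleftrightarrow> (\<exists>u v. legal E S u v \<and> \<not> wins E (S - {u, v}))"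
  using assms by (subst wins.simps) auto

lemma legal_mono: "legal E S u v \<Longrightarrow> T \<subseteq> S \<Longrightarrow> u \<in> T \<Longrightarrow> v \<in> T \<Longrightarrow> legal E T u v"
  unfolding legal_def by blast

lemma legal_image:
  assumes f: "inj_on f S" "\<And>x y. x \<in> S \<Longrightarrow> y \<in> S \<Longrightarrow> E (f x) (f y) \<longleftrightarrow> E x y"
    and uv: "u \<in> S" "v \<in> S"
  shows "legal E (f ` S) (f u) (f v) \<longleftrightarrow> legal E S u v"
proof -
  have "f ` S - {f u, f v} = f ` (S - {u, v})"
    using f(1) uv by (auto simp: inj_on_def)
  moreover have "f x = f y \<longleftrightarrow> x = y" if "x \<in> S" "y \<in> S" for x y
    using f(1) that by (auto simp: inj_on_def)
  ultimately show ?thesis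
    using f(2) uv by (simp add: legal_def)
qed

text \<open>An isomorphism of positions carries plays to plays. Both positions live under the same
  \<open>E\<close>, which is the setting in which twins are exchanged.\<close>

lemma wins_image:
  assumes "finite S" "inj_on f S" "\<And>x y. x \<in> S \<Longrightarrow> y \<in> S \<Longrightarrow> E (f x) (f y) \<longleftrightarrow> E x y"
  shows "wins E (f ` S) \<longleftrightarrow> wins E S"
  using assms
proof (induction "card S" arbitrary: S rule: less_induct)
  case less
  have *: "wins E (f ` S - {f u, f v}) \<longleftrightarrow> wins E (S - {u, v})" if "u \<in> S" "v \<in> S" for u v
  proof -
    have "f ` S - {f u, f v} = f ` (S - {u, v})"
      using less.prems(2) that by (auto simp: inj_on_def)
    moreover have "card (S - {u, v}) < card S"
      using less.prems(1) that by (intro psubset_card_mono) auto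
    ultimately show ?thesis
      using less.hyps[of "S - {u, v}"] less.prems by (simp add: inj_on_diff)
  qed
  have "wins E (f ` S) \<longleftrightarrow> (\<exists>u\<in>S. \<exists>v\<in>S. legal E (f ` S) (f u) (f v) \<and> \<not> wins E (f ` S - {f u, f v}))"
  proof (subst wins_iff)
    have "u \<in> f ` S \<and> v \<in> f ` S" if "legal E (f ` S) u v" for u v
      using that by (simp add: legal_def)
    then show "(\<exists>u v. legal E (f ` S) u v \<and> \<not> wins E (f ` S - {u, v})) \<longleftrightarrow>
        (\<exists>u\<in>S. \<exists>v\<in>S. legal E (f ` S) (f u) (f v) \<and> \<not> wins E (f ` S - {f u, f v}))"
      by blast
  qed (use less.prems(1) in simp)
  also have "\<dots> \<longleftrightarrow> (\<exists>u\<in>S. \<exists>v\<in>S. legal E S u v \<and> \<not> wins E (S - {u, v}))"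
    using * legal_image[where E = E and f = f and S = S, OF less.prems(2,3)] by blast
  also have "\<dots> \<longleftrightarrow> wins E S"
    using less.prems(1) by (subst wins_iff) (auto simp: legal_def)
  finally show ?case .
qed

text \<open>Two legal moves that share the vertex \<open>u\<close> remove twins, so that they lead to isomorphic positions.\<close>

lemma wins_twins:
  assumes "symp E" "irreflp E" "finite S" "legal E S u v" "legal E S u w"
  shows "wins E (S - {u, v}) \<longleftrightarrow> wins E (S - {u, w})"
proof (cases "v = w")
  case False
  have sym: "E x y \<longleftrightarrow> E y x" for x y
    using assms(1) by (auto simp: symp_def)
  have irr: "\<not> E x x" for x
    using assms(2) by (auto simp: irreflp_def)
  have uvw: "u \<in> S" "v \<in> S" "w \<in> S" "u \<noteq> v" "u \<noteq> w"
    using assms(4,5) irr by (auto simp: legal_def)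
  \<comment> \<open>As \<open>w\<close> is a neighbour of \<open>u\<close>, legality of
    \<open>(u, v)\<close> joins it to every other neighbour of \<open>v\<close>; legality of
    \<open>(u, w)\<close> gives the converse.\<close>
  have tw: "E v x \<longleftrightarrow> E w x" if "x \<in> S - {u, v, w}" for x
    using assms(4,5) that uvw False unfolding legal_def
    by (metis DiffE DiffI insertCI insertE singletonD sym)
  define f where "f x = (if x = w then v else x)" for x
  have "f ` (S - {u, v}) = S - {u, w}"
    using uvw False by (auto simp: f_def image_iff)
  moreover have "wins E (f ` (S - {u, v})) \<longleftrightarrow> wins E (S - {u, v})"
  proof (rule wins_image)
    show "inj_on f (S - {u, v})"
      by (auto simp: f_def inj_on_def)
    show "E (f x) (f y) \<longleftrightarrow> E x y" if "x \<in> S - {u, v}" "y \<in> S - {u, v}" for x y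
      using that tw sym irr by (auto simp: f_def)
  qed (use assms(3) in auto)
  ultimately show ?thesis
    by simp
qed auto

lemma legal_sym: "symp E \<Longrightarrow> legal E S u v \<Longrightarrow> legal E S v u"
  unfolding legal_def by (auto simp: symp_def insert_commute)

lemma wins_option_unique:
  assumes "symp E" "irreflp E" "finite S" "legal E S u v" "legal E S a b"
  shows "wins E (S - {u, v}) \<longleftrightarrow> wins E (S - {a, b})"
  using assms(3-)
proof (induction "card S" arbitrary: S u v a b rule: less_induct)
  case less
  note E = assms(1,2)
  note legal = less.prems(2,3) less.prems(2,3)[THEN legal_sym[OF assms(1)]]
  have comm: "S - {x, y} = S - {y, x}" for x y
    by blast
  consider "u = a" | "u = b" | "v = a" | "v = b" | "{u, v} \<inter> {a, b} = {}"
    by blast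
  then show ?case
  proof cases
    case 5
    \<comment> \<open>By the induction hypothesis all moves from \<open>T - {c, d}\<close> have the
      same outcome, so the still legal move \<open>(c', d')\<close> alone decides it. Both orders of
      play end in the same set.\<close>
    have step: "wins E (T - {c, d}) \<longleftrightarrow> \<not> wins E (T - {c, d} - {c', d'})"
      if T: "finite T" "card T = card S" "legal E T c d" "legal E T c' d'" "{c, d} \<inter> {c', d'} = {}" for T c d c' d'
    proof -
      have "legal E (T - {c, d}) c' d'"
        using T by (intro legal_mono[OF T(4)]) (auto simp: legal_def)
      moreover have "card (T - {c, d}) < card S"
        unfolding T(2)[symmetric] using T(1,3) by (intro psubset_card_mono) (auto simp: legal_def)
      ultimately show ?thesis
        using less.hyps[of "T - {c, d}" c' d'] T(1) wins_iff[of "T - {c, d}" E] by blast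
    qed
    have "S - {u, v} - {a, b} = S - {a, b} - {u, v}"
      by blast
    moreover have "{a, b} \<inter> {u, v} = {}"
      using 5 by blast
    ultimately show ?thesis
      using step[OF less.prems(1) refl less.prems(2,3) 5]
        step[OF less.prems(1) refl less.prems(3,2)] by simp
  qed (use wins_twins[OF E less.prems(1)] legal comm in metis)+
qed

text \<open>One arbitrary legal move decides the outcome, which is what entitles the algorithm to
  play greedily.\<close>

lemma wins_legal:
  assumes "symp E" "irreflp E" "finite S" "legal E S u v"
  shows "wins E S \<longleftrightarrow> \<not> wins E (S - {u, v})"
  using wins_iff[OF assms(3), of E] wins_option_unique[OF assms(1-3)] assms(4) by blast

section \<open>Legality is a local condition\<close>

text \<open>True of the empty set, unlike the connectedness of the library, so that it stays an
  invariant when the last two vertices are taken.\<close>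

definition connected_set :: "('a \<Rightarrow> 'a \<Rightarrow> bool) \<Rightarrow> 'a set \<Rightarrow> bool" where
  "connected_set E S \<longleftrightarrow> (\<forall>x\<in>S. \<forall>y\<in>S. (\<lambda>a b. E a b \<and> a \<in> S \<and> b \<in> S)\<^sup>*\<^sup>* x y)"

lemma rtranclp_distinct_path:
  assumes "r\<^sup>*\<^sup>* x y"
  shows "\<exists>p. p \<noteq> [] \<and> hd p = x \<and> last p = y \<and> distinct p \<and> successively r p"
  using assms
proof induction
  case base
  show ?case by (rule exI[of _ "[x]"]) auto
next
  case (step y z)
  then obtain p where p: "p \<noteq> []" "hd p = x" "last p = y" "distinct p" "successively r p"
    by blast
  show ?case
  proof (cases "z \<in> set p")
    case True
    \<comment> \<open>A path that returns to \<open>z\<close> is cut back to its earlier visit of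
      \<open>z\<close>.\<close>
    then obtain a b where ab: "p = a @ z # b"
      by (meson split_list)
    show ?thesis
      using p unfolding ab
      by (intro exI[of _ "a @ [z]"]) (auto simp: successively_append_iff hd_append split: if_splits)
  next
    case False
    then show ?thesis
      using p step.hyps(2) by (intro exI[of _ "p @ [z]"]) (auto simp: successively_append_iff)
  qed
qed

lemma connected_set_path:
  assumes "connected_set E S" "x \<in> S" "y \<in> S"
  obtains p where "p \<noteq> []" "hd p = x" "last p = y" "distinct p" "successively E p" "set p \<subseteq> S"
proof -
  let ?r = "\<lambda>a b. E a b \<and> a \<in> S \<and> b \<in> S"
  have "?r\<^sup>*\<^sup>* x y"
    using assms by (auto simp: connected_set_def)
  then obtain p where p: "p \<noteq> []" "hd p = x" "last p = y" "distinct p" "successively ?r p"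
    using rtranclp_distinct_path[of ?r x y] by blast
  \<comment> \<open>The head is mentioned separately because \<open>successively\<close> says
    nothing about a one-element list.\<close>
  have "set q \<subseteq> S" if "successively ?r q" "q \<noteq> []" "hd q \<in> S" for q
    using that by (induction q rule: induct_list012) auto
  moreover have "successively E p"
    using p(5) by (rule successively_mono) auto
  ultimately show thesis
    using that p assms(2) by blast
qed

lemma connected_set_insert:
  assumes "connected_set E S" "y \<in> S" "E x y" "E y x"
  shows "connected_set E (insert x S)"
proof -
  define R where "R = (\<lambda>a b. E a b \<and> a \<in> insert x S \<and> b \<in> insert x S)\<^sup>*\<^sup>*"
  have "(\<lambda>a b. E a b \<and> a \<in> S \<and> b \<in> S)\<^sup>*\<^sup>* \<le> R"
    unfolding R_def by (rule rtranclp_mono) auto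
  then have sub: "R a b" if "a \<in> S" "b \<in> S" for a b
    using assms(1) that by (auto simp: connected_set_def)
  have xy: "R x y" "R y x"
    unfolding R_def using assms(2-4) by (auto intro!: r_into_rtranclp)
  have trans: "R a c" if "R a b" "R b c" for a b c
    using that by (simp add: R_def)
  have "R a b" if "a \<in> insert x S" "b \<in> insert x S" for a b
  proof (rule trans)
    show "R a y"
      using that(1) xy sub assms(2) by blast
    show "R y b"
      using that(2) xy sub assms(2) by blast
  qed
  then show ?thesis
    unfolding connected_set_def R_def[symmetric] by blast
qed

lemma connected_set_successively:
  assumes "symp E" "successively E p"
  shows "connected_set E (set p)"
  using assms(2)
proof (induction p rule: induct_list012)
  case (3 x y zs)
  then have "connected_set E (insert x (set (y # zs)))"
    using assms(1) by (intro connected_set_insert[of _ _ y]) (auto simp: symp_def)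
  then show ?case
    by simp
qed (auto simp: connected_set_def)

text \<open>The block condition rephrased for cycles: in this form it applies at once to any set of
  remaining vertices.\<close>

definition cycles_are_cliques :: "('a \<Rightarrow> 'a \<Rightarrow> bool) \<Rightarrow> bool" where
  "cycles_are_cliques E \<longleftrightarrow> (\<forall>c. distinct c \<and> 3 \<le> length c \<and> successively E c \<and> E (last c) (hd c)
     \<longrightarrow> (\<forall>x\<in>set c. \<forall>y\<in>set c. x \<noteq> y \<longrightarrow> E x y))"

text \<open>A path joining two neighbours of \<open>{u, v}\<close> in the remainder closes to a
  cycle through \<open>u\<close> or \<open>v\<close>, and a cycle is a clique.\<close>

lemma connected_diff_imp_legal:
  assumes "symp E" "cycles_are_cliques E"
    and uv: "u \<in> S" "v \<in> S" "E u v" "u \<noteq> v" and conn: "connected_set E (S - {u, v})"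
  shows "legal E S u v"
  unfolding legal_def
proof (intro conjI ballI impI)
  fix x y assume x: "x \<in> S - {u, v}" and y: "y \<in> S - {u, v}"
    and "x \<noteq> y \<and> (E u x \<or> E v x) \<and> (E u y \<or> E v y)"
  then have nb: "x \<noteq> y" "E u x \<or> E v x" "E u y \<or> E v y"
    by auto
  obtain p where p: "p \<noteq> []" "hd p = x" "last p = y" "distinct p" "successively E p" "set p \<subseteq> S - {u, v}"
    using connected_set_path[OF conn x y] .
  have sym: "E a b \<Longrightarrow> E b a" for a b
    using assms(1) by (auto simp: symp_def)
  have len: "2 \<le> length p"
    using p(1,2,3) nb(1) by (cases p; cases "tl p") auto
  have xy: "x \<in> set p" "y \<in> set p"
    using p(1-3) by auto
  \<comment> \<open>\<open>q\<close> is the detour through the removed pair that closes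
    \<open>p\<close> to a cycle: one vertex if it is adjacent to both ends, otherwise the edge
    between \<open>u\<close> and \<open>v\<close> in the fitting direction.\<close>
  have cyc: "E x y" if "q \<in> {[u], [v], [u, v], [v, u]}" "E (last q) x" "E y (hd q)" for q
  proof -
    have "distinct (q @ p)" "successively E (q @ p)"
      using that p uv(3,4) sym by (auto simp: successively_append_iff)
    moreover have "E (last (q @ p)) (hd (q @ p))" "3 \<le> length (q @ p)"
      using that p len by auto
    ultimately have "\<forall>a\<in>set (q @ p). \<forall>b\<in>set (q @ p). a \<noteq> b \<longrightarrow> E a b"
      using assms(2) unfolding cycles_are_cliques_def by blast
    then show ?thesis
      using xy nb(1) by auto
  qed
  show "E x y"
    using nb cyc[of "[u]"] cyc[of "[v]"] cyc[of "[u, v]"] cyc[of "[v, u]"] sym by auto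
qed (use uv in auto)

text \<open>A walk enters \<open>{u, v}\<close> from a neighbour of the pair and leaves it to
  another one. These two are equal or adjacent by legality, so the excursion can be skipped.\<close>

lemma legal_imp_connected_diff:
  assumes "symp E" "connected_set E S" "legal E S u v"
  shows "connected_set E (S - {u, v})"
  unfolding connected_set_def
proof (intro ballI)
  let ?r = "\<lambda>S a b. E a b \<and> a \<in> S \<and> b \<in> S"
  let ?S = "S - {u, v}"
  fix x y assume x: "x \<in> ?S" and y: "y \<in> ?S"
  have sym: "E a b \<Longrightarrow> E b a" for a b
    using assms(1) by (auto simp: symp_def)
  have "(?r S)\<^sup>*\<^sup>* x y"
    using assms(2) x y by (auto simp: connected_set_def)
  \<comment> \<open>While the walk is inside \<open>{u, v}\<close>, the invariant remembers the
    outer neighbour \<open>w\<close> from which it entered.\<close>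
  then have "(y \<notin> {u, v} \<longrightarrow> (?r ?S)\<^sup>*\<^sup>* x y) \<and>
    (y \<in> {u, v} \<longrightarrow> (\<exists>w \<in> ?S. (E u w \<or> E v w) \<and> (?r ?S)\<^sup>*\<^sup>* x w))"
  proof induction
    case base
    then show ?case using x by auto
  next
    case (step y z)
    consider "y \<notin> {u, v}" "z \<notin> {u, v}" | "y \<notin> {u, v}" "z \<in> {u, v}" | "y \<in> {u, v}" "z \<in> {u, v}"
      | "y \<in> {u, v}" "z \<notin> {u, v}" by blast
    then show ?case
    proof cases
      case 1
      then have "(?r ?S)\<^sup>*\<^sup>* x y" "?r ?S y z"
        using step by auto
      then show ?thesis
        using 1 by (metis (no_types, lifting) rtranclp.rtrancl_into_rtrancl)
    next
      case 2
      then show ?thesis using step sym by auto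
    next
      case 3
      then show ?thesis using step by auto
    next
      case 4
      then obtain w where w: "w \<in> ?S" "E u w \<or> E v w" "(?r ?S)\<^sup>*\<^sup>* x w"
        using step by auto
      have "w = z \<or> ?r ?S w z"
        using assms(3) w(1,2) 4 step.hyps(2) unfolding legal_def by auto
      then have "(?r ?S)\<^sup>*\<^sup>* x z"
        using w(3) by (metis (no_types, lifting) rtranclp.rtrancl_into_rtrancl)
      then show ?thesis
        using 4 by blast
    qed
  qed
  then show "(?r ?S)\<^sup>*\<^sup>* x y"
    using y by auto
qed

section \<open>Induced subgraphs as vertex sets; cycles inside blocks\<close>

lemma graph_induce_subgraph:
  assumes "graph G" "S \<subseteq> verts G"
  shows "graph (G \<restriction> S)"
proof -
  interpret graph G by fact
  have ind: "induced_subgraph (G \<restriction> S) G"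
    using assms(2) by (rule induced_induce)
  interpret H: digraph "G \<restriction> S"
    using ind by (rule digraphI_induced)
  interpret H: sym_digraph "G \<restriction> S"
    using ind by (rule induced_graph_imp_graph)
  show ?thesis
    by unfold_locales
qed

lemma induce_subgraph_induce: "T \<subseteq> S \<Longrightarrow> (G \<restriction> S) \<restriction> T = G \<restriction> T"
  by (auto simp: induce_subgraph_def)

lemma induce_subgraph_verts_self:
  fixes G :: "('a, 'b) pre_digraph"
  assumes "wf_digraph G"
  shows "G \<restriction> verts G = G"
proof -
  interpret wf_digraph G by fact
  show ?thesis
    by (rule pre_digraph.equality) (auto simp: induce_subgraph_def)
qed

lemma del_vert_induce_subgraph: "pre_digraph.del_vert (G \<restriction> S) v = G \<restriction> (S - {v})"
  by (auto simp: pre_digraph.del_vert_def induce_subgraph_def)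

lemma arcs_ends_induce_subgraph:
  "arcs_ends (G \<restriction> S) = {(u, v). u \<rightarrow>\<^bsub>G\<^esub> v \<and> u \<in> S \<and> v \<in> S}"
  by (auto simp: arcs_ends_def arc_to_ends_def)

lemma rtrancl_on_iff_rtranclp:
  assumes "x \<in> S"
  shows "(x, y) \<in> rtrancl_on S {(a, b). E a b \<and> a \<in> S \<and> b \<in> S}
    \<longleftrightarrow> (\<lambda>a b. E a b \<and> a \<in> S \<and> b \<in> S)\<^sup>*\<^sup>* x y" (is "?l \<longleftrightarrow> ?r\<^sup>*\<^sup>* x y")
proof
  show "?r\<^sup>*\<^sup>* x y" if ?l
    using rtrancl_on_rtranclI[OF that] by (simp add: rtranclp_rtrancl_eq)
  show ?l if "?r\<^sup>*\<^sup>* x y"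
    using that by induction (use assms in \<open>auto intro: rtrancl_on_into_rtrancl_on\<close>)
qed

lemma connected_induce_subgraph_iff:
  assumes "graph G" "S \<subseteq> verts G"
  shows "Digraph_Component.connected (G \<restriction> S) \<longleftrightarrow> S \<noteq> {} \<and> connected_set (dominates G) S"
proof -
  interpret H: graph "G \<restriction> S"
    using graph_induce_subgraph[OF assms] .
  \<comment> \<open>The library defines connectedness by the symmetrised digraph, which for a
    symmetric digraph has the same reachability.\<close>
  have "x \<rightarrow>\<^sup>*\<^bsub>mk_symmetric (G \<restriction> S)\<^esub> y \<longleftrightarrow>
      (\<lambda>a b. a \<rightarrow>\<^bsub>G\<^esub> b \<and> a \<in> S \<and> b \<in> S)\<^sup>*\<^sup>* x y" if "x \<in> S" for x y
    unfolding H.reachable_mk_symmetric_eq[OF H.sym_arcs]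
    unfolding reachable_def arcs_ends_induce_subgraph induce_subgraph_verts
    using that by (rule rtrancl_on_iff_rtranclp)
  then show ?thesis
    unfolding Digraph_Component.connected_def strongly_connected_def connected_set_def
    by simp
qed

text \<open>Among the biconnected subgraphs of \<open>G\<close> that contain \<open>H\<close>, one
  with the most vertices and arcs is maximal. Arcs are counted too because subgraphs need not be
  induced.\<close>

lemma biconnected_subset_block:
  assumes "graph G" "subgraph H G" "biconnected H"
  obtains B where "block G B" "subgraph H B"
proof -
  interpret graph G by fact
  define P where "P B \<longleftrightarrow> subgraph H B \<and> subgraph B G \<and> biconnected B" for B
  define m where "m B = card (verts B) + card (arcs B)" for B :: "('a, 'b) pre_digraph"
  have H: "wf_digraph H"
    using assms(2) by auto
  have mono: "m B \<le> m B'" if "subgraph B B'" "subgraph B' G" for B B'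
  proof -
    have "finite (verts B')" "finite (arcs B')"
      using fin_digraph_subgraph[OF that(2)] by (auto simp: fin_digraph_def fin_digraph_axioms_def)
    then show ?thesis
      using that(1) unfolding m_def by (intro add_mono card_mono) auto
  qed
  have eq: "B = B'" if sub: "subgraph B B'" "subgraph B' G" and "m B' \<le> m B" for B B'
  proof -
    have fin: "finite (verts B')" "finite (arcs B')"
      using fin_digraph_subgraph[OF sub(2)] by (auto simp: fin_digraph_def fin_digraph_axioms_def)
    have sub': "verts B \<subseteq> verts B'" "arcs B \<subseteq> arcs B'" "compatible B' B"
      using sub(1) by auto
    then have "card (verts B) \<le> card (verts B')" "card (arcs B) \<le> card (arcs B')"
      using fin by (simp_all add: card_mono)
    then have "card (verts B) = card (verts B')" "card (arcs B) = card (arcs B')"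
      using \<open>m B' \<le> m B\<close> by (simp_all add: m_def)
    then show ?thesis
      using fin sub' by (intro pre_digraph.equality) (auto simp: card_subset_eq compatible_def)
  qed
  have "P H"
    using assms(2,3) wf_digraph.subgraph_refl[OF H] by (simp add: P_def)
  moreover have "m B < Suc (m G)" if "P B" for B
    using that mono[of B G] subgraph_refl by (simp add: P_def less_Suc_eq_le)
  ultimately obtain B where B: "P B" "\<And>B'. P B' \<Longrightarrow> m B' \<le> m B"
    using ex_has_greatest_nat[of P H m "Suc (m G)"] by blast
  have "block G B"
    unfolding block_def pre_digraph.max_subgraph_def
    using B eq subgraph_trans unfolding P_def by metis
  then show thesis
    using that B(1) by (auto simp: P_def)
qed

lemma cycle_rest_connected_set:
  assumes "symp E" "distinct c" "successively E c" "E (last c) (hd c)" "v \<in> set c"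
  shows "connected_set E (set c - {v})"
proof -
  obtain a b where c: "c = a @ v # b"
    using assms(5) by (meson split_list)
  \<comment> \<open>The cycle is rotated to start just after \<open>v\<close>; the closing edge
    joins \<open>b\<close> to \<open>a\<close>.\<close>
  have "successively E (b @ a)"
    using assms(3,4) unfolding c
    by (cases "a = []"; cases "b = []") (auto simp: successively_append_iff successively_Cons)
  moreover have "set c - {v} = set (b @ a)"
    using assms(2) unfolding c by auto
  ultimately show ?thesis
    using connected_set_successively[OF assms(1)] by metis
qed

lemma graph_dominates:
  assumes "graph G"
  shows "symp (dominates G)" "irreflp (dominates G)"
proof -
  interpret graph G by fact
  show "symp (dominates G)"
    by (auto simp: symp_def dest: graph_symmetric)
  show "irreflp (dominates G)"
    using no_loops by (auto simp: irreflp_def arcs_ends_def arc_to_ends_def)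
qed

text \<open>A cycle minus a vertex is a path, so the subgraph induced by the cycle has no cut
  vertex. It therefore lies in a block, and blocks are complete.\<close>

lemma clique_tree_cycles:
  assumes "clique_tree G"
  shows "cycles_are_cliques (dominates G)"
  unfolding cycles_are_cliques_def
proof (intro allI impI)
  fix c assume "distinct c \<and> 3 \<le> length c \<and> successively (dominates G) c \<and> last c \<rightarrow>\<^bsub>G\<^esub> hd c"
  then have c: "distinct c" "3 \<le> length c" "successively (dominates G) c" "last c \<rightarrow>\<^bsub>G\<^esub> hd c"
    by auto
  have G: "graph G"
    using assms by (simp add: clique_tree_def)
  interpret graph G by fact
  have sub: "set c \<subseteq> verts G"
  proof
    fix x assume "x \<in> set c"
    then obtain a b where ab: "c = a @ x # b"
      by (meson split_list)
    show "x \<in> verts G"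
    proof (cases b)
      case Nil
      then show ?thesis
        using c(4) adj_in_verts by (auto simp: ab)
    next
      case (Cons y ys)
      then show ?thesis
        using c(3) adj_in_verts by (auto simp: ab successively_append_iff)
    qed
  qed
  have "c \<noteq> []"
    using c(2) by auto
  have "biconnected (G \<restriction> set c)"
    unfolding biconnected_def
  proof (intro conjI notI)
    show "graph (G \<restriction> set c)"
      using graph_induce_subgraph[OF G sub] .
    show "Digraph_Component.connected (G \<restriction> set c)"
      unfolding connected_induce_subgraph_iff[OF G sub]
      using \<open>c \<noteq> []\<close> connected_set_successively[OF graph_dominates(1)[OF G] c(3)] by simp
    assume "\<exists>v. cut_vertex (G \<restriction> set c) v"
    then obtain v where v: "cut_vertex (G \<restriction> set c) v" ..
    then have "v \<in> set c"
      by (simp add: cut_vertex_def)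
    then have "connected_set (dominates G) (set c - {v})"
      using cycle_rest_connected_set[OF graph_dominates(1)[OF G] c(1,3,4)] by blast
    \<comment> \<open>The empty graph does not count as connected, so the cycle must keep a vertex
      after losing \<open>v\<close>.\<close>
    moreover have "card (set c - {v}) = length c - 1"
      using \<open>v \<in> set c\<close> distinct_card[OF c(1)] by simp
    then have "set c - {v} \<noteq> {}"
      using c(2) by (metis card.empty diff_is_0_eq numeral_le_one_iff order_trans semiring_norm(70))
    moreover have "set c - {v} \<subseteq> verts G"
      using sub by blast
    ultimately show False
      using v by (simp add: cut_vertex_def del_vert_induce_subgraph connected_induce_subgraph_iff[OF G])
  qed
  then obtain B where B: "block G B" "subgraph (G \<restriction> set c) B"
    using biconnected_subset_block[OF G subgraph_induce_subgraphI[OF sub]] by blast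
  have "subgraph B G"
    using B(1) by (simp add: block_def pre_digraph.max_subgraph_def)
  have "complete_digraph (card (verts B)) B"
    using assms B(1) by (simp add: clique_tree_def)
  then have "x \<rightarrow>\<^bsub>B\<^esub> y" if "x \<in> verts B" "y \<in> verts B" "x \<noteq> y" for x y
    using that by (simp add: complete_digraph_def)
  moreover have "set c \<subseteq> verts B"
    using B(2) by (auto simp: subgraph_def)
  ultimately show "\<forall>x\<in>set c. \<forall>y\<in>set c. x \<noteq> y \<longrightarrow> x \<rightarrow>\<^bsub>G\<^esub> y"
    using \<open>subgraph B G\<close> adj_mono by blast
qed

section \<open>Translation of the game on graphs into the game on vertex sets\<close>

lemma ndak_move_induce_subgraph_iff:
  assumes G: "graph G" "cycles_are_cliques (dominates G)"
    and S: "S \<subseteq> verts G" "connected_set (dominates G) S"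
  shows "ndak_move (G \<restriction> S) G' \<longleftrightarrow> (\<exists>u v. legal (dominates G) S u v \<and> G' = G \<restriction> (S - {u, v}))"
proof -
  \<comment> \<open>The separate disjunct covers the empty remainder, which
    \<open>connected_set\<close> accepts and the library's connectedness rejects.\<close>
  have *: "(S - {u, v} = {} \<or> Digraph_Component.connected (G \<restriction> (S - {u, v}))) \<longleftrightarrow>
      legal (dominates G) S u v" if "u \<rightarrow>\<^bsub>G\<^esub> v" "u \<in> S" "v \<in> S" for u v
  proof -
    have "u \<noteq> v"
      using that(1) graph_dominates(2)[OF G(1)] by (auto simp: irreflp_def)
    moreover have "S - {u, v} \<subseteq> verts G"
      using S(1) by blast
    moreover have "connected_set (dominates G) {}"
      by (simp add: connected_set_def)
    ultimately show ?thesis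
      using connected_induce_subgraph_iff[OF G(1)] that
        connected_diff_imp_legal[OF graph_dominates(1)[OF G(1)] G(2)]
        legal_imp_connected_diff[OF graph_dominates(1)[OF G(1)] S(2)]
      by metis
  qed
  have ind: "(G \<restriction> S) \<restriction> (S - {u, v}) = G \<restriction> (S - {u, v})" for u v
    by (rule induce_subgraph_induce) blast
  have "ndak_move (G \<restriction> S) G' \<longleftrightarrow> (\<exists>u v. u \<rightarrow>\<^bsub>G\<^esub> v \<and> u \<in> S \<and> v \<in> S \<and> G' = G \<restriction> (S - {u, v}) \<and>
      (S - {u, v} = {} \<or> Digraph_Component.connected (G \<restriction> (S - {u, v}))))" (is "?l \<longleftrightarrow> ?r")
  proof
    assume ?l
    then obtain u v where uv: "u \<rightarrow>\<^bsub>G\<^esub> v" "u \<in> S" "v \<in> S" "G' = G \<restriction> (S - {u, v})"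
      and "verts G' = {} \<or> Digraph_Component.connected G'"
      unfolding ndak_move_def arcs_ends_induce_subgraph induce_subgraph_verts ind by blast
    then have "S - {u, v} = {} \<or> Digraph_Component.connected (G \<restriction> (S - {u, v}))"
      by (simp only: induce_subgraph_verts)
    with uv show ?r
      by blast
  next
    assume ?r
    then obtain u v where uv: "u \<rightarrow>\<^bsub>G\<^esub> v" "u \<in> S" "v \<in> S" "G' = G \<restriction> (S - {u, v})"
      and "S - {u, v} = {} \<or> Digraph_Component.connected (G \<restriction> (S - {u, v}))"
      by blast
    then have "verts G' = {} \<or> Digraph_Component.connected G'"
      by (simp only: induce_subgraph_verts)
    with uv show ?l
      unfolding ndak_move_def arcs_ends_induce_subgraph induce_subgraph_verts ind by blast
  qed
  also have "\<dots> \<longleftrightarrow> (\<exists>u v. legal (dominates G) S u v \<and> G' = G \<restriction> (S - {u, v}))"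
  proof -
    have "legal (dominates G) S u v \<longleftrightarrow> u \<rightarrow>\<^bsub>G\<^esub> v \<and> u \<in> S \<and> v \<in> S \<and>
        (S - {u, v} = {} \<or> Digraph_Component.connected (G \<restriction> (S - {u, v})))" for u v
    proof (cases "u \<rightarrow>\<^bsub>G\<^esub> v \<and> u \<in> S \<and> v \<in> S")
      case True
      with *[of u v] show ?thesis
        by (simp only: simp_thms)
    next
      case False
      then show ?thesis
        by (auto simp: legal_def)
    qed
    then show ?thesis
      by (simp only: conj_assoc) (simp only: conj_ac)
  qed
  finally show ?thesis .
qed

lemma first_player_wins_iff:
  "first_player_wins G \<longleftrightarrow> (\<exists>G'. ndak_move G G' \<and> (\<forall>G''. ndak_move G' G'' \<longrightarrow> first_player_wins G''))"
  by (subst first_player_wins.simps) blast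

text \<open>\<open>first_player_wins\<close> recurs over a move and its reply, \<open>wins\<close>
  over a single move. Hence \<open>wins\<close> is unfolded twice and the induction hypothesis is
  used two moves down.\<close>

lemma first_player_wins_induce_subgraph_iff:
  assumes G: "graph G" "cycles_are_cliques (dominates G)"
    and S: "S \<subseteq> verts G" "connected_set (dominates G) S"
  shows "first_player_wins (G \<restriction> S) \<longleftrightarrow> wins (dominates G) S"
  using S
proof (induction "card S" arbitrary: S rule: less_induct)
  case less
  let ?E = "dominates G"
  have fin: "finite S" if "S \<subseteq> verts G" for S
    using that G(1) fin_digraph.finite_verts finite_subset
    by (metis graph_def digraph_def)
  have sub: "T - {u, v} \<subseteq> verts G" "connected_set ?E (T - {u, v})" "card (T - {u, v}) < card T"
    if "legal ?E T u v" "T \<subseteq> verts G" "connected_set ?E T" for T u v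
  proof -
    show "T - {u, v} \<subseteq> verts G"
      using that by blast
    show "connected_set ?E (T - {u, v})"
      using legal_imp_connected_diff[OF graph_dominates(1)[OF G(1)] that(3,1)] .
    have "T - {u, v} \<subset> T"
      using that(1) by (auto simp: legal_def)
    then show "card (T - {u, v}) < card T"
      using fin[OF that(2)] by (simp add: psubset_card_mono)
  qed
  have opt: "(\<forall>G''. ndak_move (G \<restriction> (S - {u, v})) G'' \<longrightarrow> first_player_wins G'')
      \<longleftrightarrow> \<not> wins ?E (S - {u, v})" if uv: "legal ?E S u v" for u v
  proof -
    let ?T = "S - {u, v}"
    note T = sub[OF uv less.prems]
    have "first_player_wins (G \<restriction> (?T - {a, b})) \<longleftrightarrow> wins ?E (?T - {a, b})"
      if "legal ?E ?T a b" for a b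
      using sub[OF that T(1,2)] T(3) by (intro less.hyps) auto
    then show ?thesis
      unfolding ndak_move_induce_subgraph_iff[OF G T(1,2)] wins_iff[OF fin[OF T(1)]]
      by blast
  qed
  have "first_player_wins (G \<restriction> S) \<longleftrightarrow> (\<exists>u v. legal ?E S u v \<and>
      (\<forall>G''. ndak_move (G \<restriction> (S - {u, v})) G'' \<longrightarrow> first_player_wins G''))"
    unfolding first_player_wins_iff[of "G \<restriction> S"] ndak_move_induce_subgraph_iff[OF G less.prems]
    by blast
  also have "\<dots> \<longleftrightarrow> wins ?E S"
    unfolding wins_iff[OF fin[OF less.prems(1)]] using opt by blast
  finally show ?case .
qed

theorem first_player_wins_clique_tree:
  assumes "clique_tree G"
  shows "first_player_wins G \<longleftrightarrow> wins (dominates G) (verts G)"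
proof -
  have G: "graph G" "Digraph_Component.connected G"
    using assms by (auto simp: clique_tree_def)
  then have "G \<restriction> verts G = G"
    by (intro induce_subgraph_verts_self) (simp add: graph_def digraph_def fin_digraph_def)
  then show ?thesis
    using first_player_wins_induce_subgraph_iff[OF G(1) clique_tree_cycles[OF assms] order_refl]
      connected_induce_subgraph_iff[OF G(1) order_refl] G(2) by simp
qed

section \<open>Structured programs for the random access machine\<close>

type_synonym assertion = "(nat \<Rightarrow> nat) \<Rightarrow> bool list \<Rightarrow> bool"

fun is_jump :: "instr \<Rightarrow> bool" where
  "is_jump (JumpPos j l) = True"
| "is_jump _ = False"

definition exec_state :: "instr \<Rightarrow> (nat \<Rightarrow> nat) \<times> bool list \<Rightarrow> (nat \<Rightarrow> nat) \<times> bool list" where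
  "exec_state i s = snd (exec i (0, s))"

lemma exec_no_jump: "\<not> is_jump i \<Longrightarrow> exec i (pc, s) = (Suc pc, exec_state i s)"
  by (cases "(i, pc, s)" rule: exec.cases) (auto simp: exec_state_def)

lemma exec_state_simps [simp]:
  "exec_state (Const i c) (R, w) = (R(i := c), w)"
  "exec_state (Add i j k) (R, w) = (R(i := R j + R k), w)"
  "exec_state (Sub i j k) (R, w) = (R(i := R j - R k), w)"
  "exec_state (Load i j) (R, w) = (R(i := R (R j)), w)"
  "exec_state (Store i j) (R, w) = (R(R i := R j), w)"
  "exec_state (Read i) (R, b # w) = (R(i := of_bool b), w)"
  by (auto simp: exec_state_def)

text \<open>A conditional backward jump implements a loop tested at its end directly, and
  conditionals are replaced by arithmetic. Every loop body runs at least once, hence the later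
  assumption \<open>0 < n\<close>; a connected graph has a vertex.\<close>

datatype com = Straight "instr list" | Seq com com (infixr ";;" 60) | DoWhile com nat

text \<open>\<open>l\<close> is the address at which the code will stand, since jump targets are
  absolute.\<close>

fun compile :: "nat \<Rightarrow> com \<Rightarrow> instr list" where
  "compile l (Straight is) = is"
| "compile l (a ;; b) = compile l a @ compile (l + length (compile l a)) b"
| "compile l (DoWhile c j) = compile l c @ [JumpPos j l]"

text \<open>Total correctness with a step bound. Quantifying over the surrounding code makes triples
  relocatable and so composable.\<close>

definition hoare :: "assertion \<Rightarrow> com \<Rightarrow> nat \<Rightarrow> assertion \<Rightarrow> bool" where
  "hoare A c T B \<longleftrightarrow> (\<forall>pre post R w. A R w \<longrightarrow>
     (\<exists>t \<le> T. \<exists>R' w'. (step (pre @ compile (length pre) c @ post) ^^ t) (length pre, R, w)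
        = (length pre + length (compile (length pre) c), R', w') \<and> B R' w'))"

lemma hoareE:
  assumes "hoare A c T B" "A R w" "l = length pre" "m = l + length (compile l c)"
    "P = pre @ compile l c @ post"
  obtains t R' w' where "t \<le> T" "(step P ^^ t) (l, R, w) = (m, R', w')" "B R' w'"
  using assms unfolding hoare_def by blast

lemma hoare_conseq:
  assumes "hoare A c T B" "\<And>R w. A' R w \<Longrightarrow> A R w" "\<And>R w. B R w \<Longrightarrow> B' R w" "T \<le> T'"
  shows "hoare A' c T' B'"
  using assms unfolding hoare_def by (meson order_trans)

lemma hoare_Straight:
  assumes "\<forall>i\<in>set is. \<not> is_jump i"
    and "\<And>R w. A R w \<Longrightarrow> \<exists>R' w'. fold exec_state is (R, w) = (R', w') \<and> B R' w'"
  shows "hoare A (Straight is) (length is) B"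
  unfolding hoare_def
proof (intro allI impI)
  fix pre post :: "instr list" and R w assume "A R w"
  have "(step (pre @ is @ post) ^^ length is) (length pre, s) = (length pre + length is, fold exec_state is s)"
    for s
    using assms(1)
  proof (induction "is" arbitrary: pre s)
    case (Cons i "is")
    have "step (pre @ (i # is) @ post) (length pre, s) = (Suc (length pre), exec_state i s)"
      using Cons.prems exec_no_jump[of i] by (cases s) (auto simp: nth_append)
    then show ?case
      using Cons.IH[of "pre @ [i]" "exec_state i s"] Cons.prems
      by (simp add: funpow_Suc_right del: funpow.simps)
  qed simp
  from this[of "(R, w)"] show "\<exists>t\<le>length is. \<exists>R' w'.
      (step (pre @ compile (length pre) (Straight is) @ post) ^^ t) (length pre, R, w)
        = (length pre + length (compile (length pre) (Straight is)), R', w') \<and> B R' w'"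
    using assms(2)[OF \<open>A R w\<close>] by (auto intro!: exI[of _ "length is"])
qed

lemma hoare_Seq:
  assumes "hoare A a T B" "hoare B b U C"
  shows "hoare A (a ;; b) (T + U) C"
  unfolding hoare_def
proof (intro allI impI)
  fix pre post :: "instr list" and R w assume "A R w"
  let ?l = "length pre"
  let ?x = "compile ?l a"
  let ?m = "?l + length ?x"
  let ?y = "compile ?m b"
  let ?P = "pre @ compile ?l (a ;; b) @ post"
  obtain t R' w' where 1: "t \<le> T" "(step ?P ^^ t) (?l, R, w) = (?m, R', w')" "B R' w'"
    by (rule hoareE[OF assms(1) \<open>A R w\<close> refl refl, where P = ?P and post = "?y @ post"]) simp_all
  obtain u R'' w'' where 2: "u \<le> U" "(step ?P ^^ u) (?m, R', w') = (?m + length ?y, R'', w'')" "C R'' w''"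
    by (rule hoareE[OF assms(2) 1(3) _ refl, where P = ?P and pre = "pre @ ?x" and post = post]) simp_all
  have "(step ?P ^^ (u + t)) (?l, R, w) = (?m + length ?y, R'', w'')"
    using 1(2) 2(2) by (simp add: funpow_add)
  then show "\<exists>t\<le>T + U. \<exists>R' w'. (step ?P ^^ t) (?l, R, w) = (?l + length (compile ?l (a ;; b)), R', w') \<and> C R' w'"
    using 1(1) 2(1,3) by (intro exI[of _ "u + t"] conjI exI[of _ R''] exI[of _ w'']) auto
qed

text \<open>The invariant is indexed by the number of completed rounds, and the postcondition of the
  body ties the jump register to that index. So there are exactly \<open>m\<close> rounds, each
  paying one extra step for the jump.\<close>

lemma hoare_DoWhile:
  assumes body: "\<And>i. i < m \<Longrightarrow> hoare (I i) c T (\<lambda>R w. I (Suc i) R w \<and> (0 < R j \<longleftrightarrow> Suc i < m))"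
    and m: "0 < m"
  shows "hoare (I 0) (DoWhile c j) (m * (T + 1)) (I m)"
  unfolding hoare_def
proof (intro allI impI)
  fix pre post :: "instr list" and R w assume "I 0 R w"
  let ?l = "length pre"
  let ?x = "compile ?l c"
  let ?P = "pre @ compile ?l (DoWhile c j) @ post"
  let ?m = "?l + length ?x"
  have P: "?P = pre @ ?x @ JumpPos j ?l # post"
    by simp
  \<comment> \<open>Induction on the number \<open>k\<close> of rounds still to come.\<close>
  have "\<exists>t \<le> k * (T + 1). \<exists>R' w'. (step ?P ^^ t) (?l, R, w) = (Suc ?m, R', w') \<and> I m R' w'"
    if "I i R w" "i + k = m" "0 < k" for i k R w
    using that
  proof (induction k arbitrary: i R w)
    case (Suc k)
    then have "i < m"
      by simp
    define J where "J = (\<lambda>R w. I (Suc i) R w \<and> (0 < R j \<longleftrightarrow> Suc i < m))"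
    have "hoare (I i) c T J"
      using body[OF \<open>i < m\<close>] by (simp only: J_def)
    then obtain t R' w' where t: "t \<le> T" "(step ?P ^^ t) (?l, R, w) = (?m, R', w')" and "J R' w'"
      by (rule hoareE[where A = "I i" and R = R and w = w, OF _ Suc.prems(1) refl refl P])
    then have I: "I (Suc i) R' w' \<and> (0 < R' j \<longleftrightarrow> Suc i < m)"
      by (simp only: J_def)
    have "step ?P (?m, R', w') = (if 0 < R' j then ?l else Suc ?m, R', w')"
      by (simp add: nth_append)
    then have s: "(step ?P ^^ Suc t) (?l, R, w) = (if 0 < R' j then ?l else Suc ?m, R', w')"
      using t(2) by simp
    show ?case
    proof (cases "k = 0")
      case True
      then have "Suc i = m" "\<not> 0 < R' j"
        using Suc.prems(2) I by auto
      then show ?thesis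
        using s t(1) I True by (intro exI[of _ "Suc t"]) auto
    next
      case False
      then have "0 < R' j"
        using Suc.prems(2) I by auto
      moreover obtain u R'' w'' where u: "u \<le> k * (T + 1)"
        "(step ?P ^^ u) (?l, R', w') = (Suc ?m, R'', w'')" "I m R'' w''"
        using Suc.IH[of "Suc i" R' w'] I Suc.prems(2) False by auto
      ultimately have "(step ?P ^^ (u + Suc t)) (?l, R, w) = (Suc ?m, R'', w'')"
        using s unfolding funpow_add by simp
      then show ?thesis
        using u(1,3) t(1) by (intro exI[of _ "u + Suc t"] conjI exI[of _ R''] exI[of _ w'']) auto
    qed
  qed simp
  from this[OF \<open>I 0 R w\<close>, of m]
  show "\<exists>t\<le>m * (T + 1). \<exists>R' w'. (step ?P ^^ t) (?l, R, w)
      = (?l + length (compile ?l (DoWhile c j)), R', w') \<and> I m R' w'"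
    using m by simp
qed

lemma hoare_answers_within:
  assumes "hoare A c T (\<lambda>R w. R 0 = of_bool b)" "A (\<lambda>_. 0) w"
  shows "answers_within (compile 0 c) w T b"
proof -
  obtain t R' w' where "t \<le> T" "(step (compile 0 c) ^^ t) (0, \<lambda>_. 0, w) = (length (compile 0 c), R', w')"
    "R' 0 = of_bool b"
    by (rule hoareE[OF assms, where pre = "[]" and post = "[]" and P = "compile 0 c"]) simp_all
  then show ?thesis
    unfolding answers_within_def by blast
qed

section \<open>The greedy algorithm\<close>

fun play :: "('a \<Rightarrow> 'a \<Rightarrow> bool) \<Rightarrow> 'a \<times> 'a \<Rightarrow> 'a set \<times> bool \<Rightarrow> 'a set \<times> bool" where
  "play E (u, v) (S, p) = (if legal E S u v then (S - {u, v}, \<not> p) else (S, p))"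

lemma fst_play_subset: "fst (play E e s) \<subseteq> fst s"
  by (cases e; cases s) auto

lemma fst_fold_play_subset: "fst (fold (play E) es s) \<subseteq> fst s"
proof (induction es arbitrary: s)
  case (Cons e es)
  then show ?case
    using fst_play_subset[of E e s] by (metis fold_simps(2) order_trans)
qed simp

text \<open>A legal move flips both the outcome and the parity, so their exclusive or is invariant.
  Once no move is left, it equals the parity.\<close>

lemma wins_play:
  assumes "symp E" "irreflp E" "finite (fst s)"
  shows "(wins E (fst (play E e s)) \<noteq> snd (play E e s)) \<longleftrightarrow> (wins E (fst s) \<noteq> snd s)"
  using wins_legal[OF assms(1,2)] assms(3) by (cases e; cases s) auto

lemma wins_fold_play:
  assumes "symp E" "irreflp E" "finite (fst s)"
  shows "(wins E (fst (fold (play E) es s)) \<noteq> snd (fold (play E) es s)) \<longleftrightarrow> (wins E (fst s) \<noteq> snd s)"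
  using assms(3)
proof (induction es arbitrary: s)
  case (Cons e es)
  then show ?case
    using wins_play[OF assms(1,2), of s e] finite_subset[OF fst_play_subset] by (metis fold_simps(2))
qed simp

text \<open>Until a move is made, all pairs are tested against the same set; the first legal pair
  removes vertices for good.\<close>

lemma fold_play_progress:
  assumes "finite (fst s)"
  shows "fst (fold (play E) es s) = fst s \<and> (\<forall>(u, v)\<in>set es. \<not> legal E (fst s) u v)
    \<or> card (fst (fold (play E) es s)) < card (fst s)"
  using assms
proof (induction es arbitrary: s)
  case (Cons e es)
  obtain u v S p where e: "e = (u, v)" and s: "s = (S, p)"
    by (metis surj_pair)
  show ?case
  proof (cases "legal E S u v")
    case True
    have "fst (fold (play E) (e # es) s) \<subseteq> S - {u, v}"
      using fst_fold_play_subset[of E es "(S - {u, v}, \<not> p)"] True by (simp add: e s)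
    moreover have "S - {u, v} \<subset> S"
      using True by (auto simp: legal_def)
    ultimately show ?thesis
      using Cons.prems by (simp add: s psubset_card_mono)
  next
    case False
    then show ?thesis
      using Cons.IH[of s] Cons.prems by (auto simp: e s)
  qed
qed simp

text \<open>The pairs that precede \<open>(u, v)\<close> lexicographically, that is, those already
  tried when the loops stand there; \<open>(n, 0)\<close> marks a complete sweep.\<close>

definition pairs_below :: "nat \<Rightarrow> nat \<Rightarrow> nat \<Rightarrow> (nat \<times> nat) list" where
  "pairs_below n u v = List.product [0..<u] [0..<n] @ map (Pair u) [0..<v]"

lemma pairs_below_Suc: "pairs_below n u (Suc v) = pairs_below n u v @ [(u, v)]"
  by (simp add: pairs_below_def)

lemma pairs_below_end: "pairs_below n (Suc u) 0 = pairs_below n u n"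
  by (simp add: pairs_below_def product_concat_map)

lemma pairs_below_start: "pairs_below n 0 0 = []"
  by (simp add: pairs_below_def)

text \<open>
  An illegal move may become legal later, when a part that it would cut off has been removed. Hence
  the pairs are tried again until a whole sweep makes no move, which must happen within \<open>n\<close> sweeps.
\<close>

definition sweeps :: "(nat \<Rightarrow> nat \<Rightarrow> bool) \<Rightarrow> nat \<Rightarrow> nat \<Rightarrow> nat set \<times> bool" where
  "sweeps E n k = (fold (play E) (pairs_below n n 0) ^^ k) ({..<n}, False)"

text \<open>The last conjunct is the clock: as long as a legal move remains, each sweep so far has
  removed at least one vertex.\<close>

lemma sweeps_invariant:
  assumes "symp E" "irreflp E"
  shows "fst (sweeps E n k) \<subseteq> {..<n}
    \<and> (wins E (fst (sweeps E n k)) \<noteq> snd (sweeps E n k) \<longleftrightarrow> wins E {..<n})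
    \<and> ((\<forall>u v. \<not> legal E (fst (sweeps E n k)) u v) \<or> card (fst (sweeps E n k)) + k \<le> n)"
proof (induction k)
  case 0
  then show ?case
    by (simp add: sweeps_def)
next
  case (Suc k)
  let ?f = "fold (play E) (pairs_below n n 0)"
  let ?s = "sweeps E n k"
  have S: "sweeps E n (Suc k) = ?f ?s"
    by (simp add: sweeps_def)
  have fin: "finite (fst ?s)"
    using Suc finite_subset by blast
  have "fst (?f ?s) \<subseteq> {..<n}"
    using Suc fst_fold_play_subset[of E "pairs_below n n 0" ?s] by blast
  moreover have "wins E (fst (?f ?s)) \<noteq> snd (?f ?s) \<longleftrightarrow> wins E {..<n}"
    using Suc wins_fold_play[OF assms fin] by blast
  moreover have "(\<forall>u v. \<not> legal E (fst (?f ?s)) u v) \<or> card (fst (?f ?s)) + Suc k \<le> n"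
  proof (cases "fst (?f ?s) = fst ?s \<and> (\<forall>(u, v)\<in>set (pairs_below n n 0). \<not> legal E (fst ?s) u v)")
    case True
    have "\<not> legal E (fst ?s) u v" for u v
    proof
      assume *: "legal E (fst ?s) u v"
      then have "u \<in> {..<n}" "v \<in> {..<n}"
        using Suc unfolding legal_def by blast+
      then have "(u, v) \<in> set (pairs_below n n 0)"
        by (simp add: pairs_below_def)
      then show False
        using True * by auto
    qed
    then show ?thesis
      using True by simp
  next
    case False
    then have less: "card (fst (?f ?s)) < card (fst ?s)"
      using fold_play_progress[OF fin] by blast
    \<comment> \<open>A sweep that removed vertices started from a position with a legal move, which
      rules out the first alternative of the induction hypothesis.\<close>
    have "\<exists>u v. legal E (fst ?s) u v"
    proof (rule ccontr)
      assume "\<nexists>u v. legal E (fst ?s) u v"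
      then have "play E e ?s = ?s" for e
        by (cases e; cases ?s) auto
      then have "fold (play E) es ?s = ?s" for es
        by (induction es) auto
      then show False
        using less by simp
    qed
    then show ?thesis
      using Suc less by auto
  qed
  ultimately show ?case
    unfolding S by blast
qed

text \<open>After \<open>n\<close> sweeps the clock leaves no vertex or no legal move. Either way
  the player to move has lost, and the parity is the outcome of the start.\<close>

lemma snd_sweeps:
  assumes "symp E" "irreflp E"
  shows "snd (sweeps E n n) \<longleftrightarrow> wins E {..<n}"
proof -
  let ?S = "fst (sweeps E n n)"
  note inv = sweeps_invariant[OF assms, of n n]
  have "finite ?S"
    using inv[THEN conjunct1] finite_subset by blast
  moreover have "\<not> legal E ?S u v" for u v
  proof (cases "card ?S + n \<le> n")
    case True
    then have "?S = {}"
      using \<open>finite ?S\<close> by simp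
    then show ?thesis
      by (simp add: legal_def)
  next
    case False
    then show ?thesis
      using inv[THEN conjunct2, THEN conjunct2] by (simp only: simp_thms)
  qed
  ultimately have "\<not> wins E ?S"
    using wins_iff[of ?S E] by simp
  then show ?thesis
    using inv[THEN conjunct2, THEN conjunct1] by (simp only: simp_thms)
qed

section \<open>The program\<close>

definition row :: "nat \<Rightarrow> nat \<Rightarrow> nat" where
  "row n i = 40 + n + i * n"

lemma row_Suc: "row n (Suc i) = row n i + n"
  by (simp add: row_def)

text \<open>
  Register 0 holds the parity of the number of moves, register 2 the constant 1, register 3 the number
  of vertices. The table of removed vertices starts at the address 40, kept in register 11, and is
  followed by the rows of the adjacency matrix. The remaining registers below 40 are scratch: 4 to 7
  hold the loop variables \<open>u\<close>, \<open>v\<close>, \<open>x\<close>, \<open>y\<close>, 8 to 10 the addresses of the rows \<open>u\<close>, \<open>v\<close>, \<open>x\<close>, 12 the result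
  of the legality test, 13 the loop condition and 20 the number of completed sweeps.
\<close>

definition layout :: "nat \<Rightarrow> (nat \<Rightarrow> nat \<Rightarrow> bool) \<Rightarrow> nat set \<times> bool \<Rightarrow> (nat \<Rightarrow> nat) \<Rightarrow> bool" where
  "layout n E s R \<longleftrightarrow> R 3 = n \<and> R 2 = 1 \<and> R 11 = 40 \<and> R 0 = of_bool (snd s)
     \<and> (\<forall>i<n. R (40 + i) = of_bool (i \<notin> fst s))
     \<and> (\<forall>i<n. \<forall>j<n. R (row n i + j) = of_bool (E i j))"

definition scratch :: "nat set" where
  "scratch = {4, 5, 6, 7, 8, 9, 10, 12, 13, 14, 15, 16, 20}"

lemma layout_cong:
  assumes "layout n E s R" "\<And>k. k \<notin> scratch \<Longrightarrow> R' k = R k"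
  shows "layout n E s R'"
proof -
  have "R' (40 + i) = R (40 + i)" "R' (row n i + j) = R (row n i + j)" for i j
    using assms(2) by (auto simp: scratch_def row_def)
  moreover have "R' 3 = R 3" "R' 2 = R 2" "R' 11 = R 11" "R' 0 = R 0"
    using assms(2) by (auto simp: scratch_def)
  ultimately show ?thesis
    using assms(1) by (simp add: layout_def)
qed

section \<open>Branch-free tests and updates\<close>

definition agree_off :: "nat set \<Rightarrow> (nat \<Rightarrow> nat) \<Rightarrow> (nat \<Rightarrow> nat) \<Rightarrow> bool" where
  "agree_off K R R' \<longleftrightarrow> (\<forall>k. k \<notin> K \<longrightarrow> R k = R' k)"

text \<open>A disjunction without jumps: register 14 grows whenever a condition is met, 15 and 16
  are temporaries. The reference state \<open>R0\<close> lets the tests be concatenated, since no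
  segment disturbs what the next one reads.\<close>

definition counts :: "(nat \<Rightarrow> nat) \<Rightarrow> instr list \<Rightarrow> bool \<Rightarrow> bool" where
  "counts R0 is c \<longleftrightarrow> (\<forall>R w. agree_off {14, 15, 16} R R0 \<longrightarrow>
     (\<exists>R'. fold exec_state is (R, w) = (R', w) \<and> agree_off {14, 15, 16} R' R0
        \<and> R 14 \<le> R' 14 \<and> (R 14 < R' 14 \<longleftrightarrow> c)))"

lemma counts_append:
  assumes "counts R0 a c" "counts R0 b d"
  shows "counts R0 (a @ b) (c \<or> d)"
  unfolding counts_def
proof (intro allI impI)
  fix R w assume "agree_off {14, 15, 16} R R0"
  then obtain R' where 1: "fold exec_state a (R, w) = (R', w)" "agree_off {14, 15, 16} R' R0"
    "R 14 \<le> R' 14" "R 14 < R' 14 \<longleftrightarrow> c"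
    using assms(1) unfolding counts_def by meson
  then obtain R'' where 2: "fold exec_state b (R', w) = (R'', w)" "agree_off {14, 15, 16} R'' R0"
    "R' 14 \<le> R'' 14" "R' 14 < R'' 14 \<longleftrightarrow> d"
    using assms(2) unfolding counts_def by meson
  have "R 14 < R'' 14 \<longleftrightarrow> c \<or> d"
    using 1(3,4) 2(3,4) by linarith
  then show "\<exists>R'. fold exec_state (a @ b) (R, w) = (R', w) \<and> agree_off {14, 15, 16} R' R0
      \<and> R 14 \<le> R' 14 \<and> (R 14 < R' 14 \<longleftrightarrow> c \<or> d)"
    using 1 2 by (intro exI[of _ R'']) simp
qed

text \<open>The two truncated differences add up to the distance of the values; 1 minus the distance
  is 1 precisely for equal values.\<close>

definition count_eq :: "nat \<Rightarrow> nat \<Rightarrow> instr list" where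
  "count_eq i j = [Sub 15 i j, Sub 16 j i, Add 15 15 16, Sub 15 2 15, Add 14 14 15]"

lemma counts_count_eq:
  assumes "R0 2 = 1" "i \<notin> {14, 15, 16}" "j \<notin> {14, 15, 16}"
  shows "counts R0 (count_eq i j) (R0 i = R0 j)"
  unfolding counts_def
proof (intro allI impI)
  fix R w assume "agree_off {14, 15, 16} R R0"
  then have "R 2 = 1" "R i = R0 i" "R j = R0 j"
    using assms by (auto simp: agree_off_def)
  then show "\<exists>R'. fold exec_state (count_eq i j) (R, w) = (R', w) \<and> agree_off {14, 15, 16} R' R0
      \<and> R 14 \<le> R' 14 \<and> (R 14 < R' 14 \<longleftrightarrow> R0 i = R0 j)"
    using assms(2,3) \<open>agree_off _ R R0\<close> by (auto simp: count_eq_def agree_off_def)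
qed

definition count_load :: "nat \<Rightarrow> nat \<Rightarrow> instr list" where
  "count_load i j = [Add 15 i j, Load 15 15, Add 14 14 15]"

text \<open>The bound 40 keeps the loaded address clear of the temporaries that the segment
  overwrites.\<close>

lemma counts_count_load:
  assumes "i \<notin> {14, 15, 16}" "j \<notin> {14, 15, 16}" "40 \<le> R0 i"
  shows "counts R0 (count_load i j) (0 < R0 (R0 i + R0 j))"
  unfolding counts_def
proof (intro allI impI)
  fix R w assume R: "agree_off {14, 15, 16} R R0"
  then have "R i = R0 i" "R j = R0 j" "R (R0 i + R0 j) = R0 (R0 i + R0 j)"
    using assms by (auto simp: agree_off_def)
  then show "\<exists>R'. fold exec_state (count_load i j) (R, w) = (R', w) \<and> agree_off {14, 15, 16} R' R0
      \<and> R 14 \<le> R' 14 \<and> (R 14 < R' 14 \<longleftrightarrow> 0 < R0 (R0 i + R0 j))"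
    using assms R by (auto simp: count_load_def agree_off_def)
qed

definition count_nonadjacent :: "nat \<Rightarrow> instr list" where
  "count_nonadjacent k =
     [Add 15 8 k, Load 15 15, Add 16 9 k, Load 16 16, Add 15 15 16, Sub 15 2 15, Add 14 14 15]"

lemma counts_count_nonadjacent:
  assumes "k \<notin> {14, 15, 16}" "40 \<le> R0 8" "40 \<le> R0 9" "R0 2 = 1"
  shows "counts R0 (count_nonadjacent k) (\<not> (0 < R0 (R0 8 + R0 k) \<or> 0 < R0 (R0 9 + R0 k)))"
  unfolding counts_def
proof (intro allI impI)
  fix R w assume R: "agree_off {14, 15, 16} R R0"
  then have "R 8 = R0 8" "R 9 = R0 9" "R 2 = 1" "R k = R0 k"
    "R (R0 8 + R0 k) = R0 (R0 8 + R0 k)" "R (R0 9 + R0 k) = R0 (R0 9 + R0 k)"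
    using assms by (auto simp: agree_off_def)
  \<comment> \<open>Register 15 already holds the first entry when the second one is loaded.\<close>
  moreover have "R0 9 + R0 k \<noteq> 15"
    using assms by linarith
  ultimately show "\<exists>R'. fold exec_state (count_nonadjacent k) (R, w) = (R', w) \<and> agree_off {14, 15, 16} R' R0
      \<and> R 14 \<le> R' 14 \<and> (R 14 < R' 14 \<longleftrightarrow> \<not> (0 < R0 (R0 8 + R0 k) \<or> 0 < R0 (R0 9 + R0 k)))"
    using assms R by (simp add: count_nonadjacent_def agree_off_def)
qed

text \<open>The pairs \<open>(x, y)\<close> that do not witness the illegality of the move \<open>(u, v)\<close>.\<close>

definition harmless :: "('a \<Rightarrow> 'a \<Rightarrow> bool) \<Rightarrow> 'a set \<Rightarrow> 'a \<Rightarrow> 'a \<Rightarrow> 'a \<Rightarrow> 'a \<Rightarrow> bool" where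
  "harmless E S u v x y \<longleftrightarrow> x \<notin> S \<or> y \<notin> S \<or> x = u \<or> x = v \<or> y = u \<or> y = v \<or> x = y
     \<or> E x y \<or> \<not> (E u x \<or> E v x) \<or> \<not> (E u y \<or> E v y)"

definition harmless_code :: "instr list" where
  "harmless_code = count_load 11 6 @ count_load 11 7
     @ count_eq 6 4 @ count_eq 6 5 @ count_eq 7 4 @ count_eq 7 5 @ count_eq 6 7
     @ count_load 10 7 @ count_nonadjacent 6 @ count_nonadjacent 7"

lemma counts_harmless_code:
  assumes "layout n E s R" "R 4 = u" "R 5 = v" "R 6 = x" "R 7 = y" "u < n" "v < n" "x < n" "y < n"
    "R 8 = row n u" "R 9 = row n v" "R 10 = row n x"
  shows "counts R harmless_code (harmless E (fst s) u v x y)"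
proof -
  have R: "R 2 = 1" "R 11 = 40" "R (40 + x) = of_bool (x \<notin> fst s)"
    "R (40 + y) = of_bool (y \<notin> fst s)" "R (row n u + x) = of_bool (E u x)"
    "R (row n v + x) = of_bool (E v x)" "R (row n u + y) = of_bool (E u y)"
    "R (row n v + y) = of_bool (E v y)" "R (row n x + y) = of_bool (E x y)"
    using assms by (auto simp: layout_def)
  have ge: "40 \<le> row n i" for i
    by (simp add: row_def)
  have load: "counts R (count_load 11 6) (x \<notin> fst s)" "counts R (count_load 11 7) (y \<notin> fst s)"
    "counts R (count_load 10 7) (E x y)"
    using counts_count_load[of 11 6 R] counts_count_load[of 11 7 R] counts_count_load[of 10 7 R]
    by (simp_all add: R ge assms)
  have eq: "counts R (count_eq 6 4) (x = u)" "counts R (count_eq 6 5) (x = v)"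
    "counts R (count_eq 7 4) (y = u)" "counts R (count_eq 7 5) (y = v)" "counts R (count_eq 6 7) (x = y)"
    using counts_count_eq[of R 6 4] counts_count_eq[of R 6 5] counts_count_eq[of R 7 4]
      counts_count_eq[of R 7 5] counts_count_eq[of R 6 7]
    by (simp_all add: R assms)
  have nonadj: "counts R (count_nonadjacent 6) (\<not> (E u x \<or> E v x))"
    "counts R (count_nonadjacent 7) (\<not> (E u y \<or> E v y))"
    using counts_count_nonadjacent[of 6 R] counts_count_nonadjacent[of 7 R]
    by (simp_all add: R ge assms)
  show ?thesis
    unfolding harmless_code_def harmless_def by (intro counts_append load eq nonadj)
qed

text \<open>Register 15 becomes 1 exactly when no excuse was counted; truncated subtraction then
  clears the flag in register 12.\<close>

definition cell_code :: "instr list" where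
  "cell_code = Const 14 0 # harmless_code @ [Sub 15 2 14, Sub 12 12 15, Add 7 7 2, Sub 13 3 7]"

lemma fold_cell_code:
  assumes "layout n E s R" "R 4 = u" "R 5 = v" "R 6 = x" "R 7 = y" "u < n" "v < n" "x < n" "y < n"
    "R 8 = row n u" "R 9 = row n v" "R 10 = row n x" and b: "R 12 = of_bool b"
  obtains R' where "fold exec_state cell_code (R, w) = (R', w)"
    "R' 12 = of_bool (b \<and> harmless E (fst s) u v x y)" "R' 7 = Suc y" "R' 13 = n - Suc y"
    "agree_off {7, 12, 13, 14, 15, 16} R' R"
proof -
  have "agree_off {14, 15, 16} (R(14 := 0)) R"
    by (simp add: agree_off_def)
  then obtain R1 where R1: "fold exec_state harmless_code (R(14 := 0), w) = (R1, w)"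
    "agree_off {14, 15, 16} R1 R" "0 < R1 14 \<longleftrightarrow> harmless E (fst s) u v x y"
    using counts_harmless_code[OF assms(1-12)] unfolding counts_def by fastforce
  have "R1 2 = Suc 0" "R1 3 = n" "R1 7 = y" "R1 12 = of_bool b"
    using R1(2) assms(1,5) b by (auto simp: agree_off_def layout_def)
  moreover have "of_bool b - (Suc 0 - R1 14) = (of_bool (b \<and> harmless E (fst s) u v x y) :: nat)"
    using R1(3) by (cases b; cases "R1 14") auto
  ultimately show thesis
    using R1(1,2) by (intro that[of "R1(15 := Suc 0 - R1 14, 12 := of_bool (b \<and> harmless E (fst s) u v x y),
        7 := Suc y, 13 := n - Suc y)"]) (simp_all add: cell_code_def agree_off_def)
qed

text \<open>Three obstacles are summed (\<open>u\<close> removed, \<open>v\<close> removed, no edge)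
  and subtracted from 1. The last two instructions prepare the loop over \<open>x\<close>, with
  \<open>40 + n\<close> the address of row 0.\<close>

definition guard_code :: "instr list" where
  "guard_code = [Add 14 11 4, Load 14 14, Add 15 11 5, Load 15 15, Add 16 8 5, Load 16 16,
     Sub 16 2 16, Add 14 14 15, Add 14 14 16, Sub 12 2 14, Const 6 0, Add 10 11 3]"

lemma row_0: "row n 0 = 40 + n"
  by (simp add: row_def)

lemma of_bool_guard:
  "Suc 0 - (of_bool (u \<notin> S) + of_bool (v \<notin> S) + (Suc 0 - of_bool b)) = (of_bool (u \<in> S \<and> v \<in> S \<and> b) :: nat)"
  by auto

lemma fold_guard_code:
  assumes "layout n E s R" "R 4 = u" "R 5 = v" "u < n" "v < n" "R 8 = row n u"
  obtains R' where "fold exec_state guard_code (R, w) = (R', w)"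
    "R' 12 = of_bool (u \<in> fst s \<and> v \<in> fst s \<and> E u v)" "R' 6 = 0" "R' 10 = row n 0"
    "agree_off {6, 10, 12, 14, 15, 16} R' R"
proof -
  have R: "R 3 = n" "R 2 = Suc 0" "R 11 = 40" "R (40 + u) = of_bool (u \<notin> fst s)"
    "R (40 + v) = of_bool (v \<notin> fst s)" "R (row n u + v) = of_bool (E u v)"
    using assms by (auto simp: layout_def)
  have ne: "row n i + j \<noteq> numeral k" "40 + j \<noteq> numeral k" if "numeral k < (40::nat)" for i j k
    using that unfolding row_def by linarith+
  obtain R' where "fold exec_state guard_code (R, w) = (R', w)"
    "R' 12 = of_bool (u \<in> fst s \<and> v \<in> fst s \<and> E u v)" "R' 6 = 0" "R' 10 = row n 0"
    "agree_off {6, 10, 12, 14, 15, 16} R' R"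
    unfolding guard_code_def agree_off_def
    by (simp add: assms(2,3,6) R ne of_bool_guard row_0)
  then show thesis
    using that by blast
qed

text \<open>Adding the 0/1 flag of register 12 marks the vertex if the move is legal and leaves the
  table alone otherwise.\<close>

definition mark_code :: "nat \<Rightarrow> instr list" where
  "mark_code i = [Add 14 11 i, Load 15 14, Add 15 15 12, Store 14 15]"

lemma fold_mark_code:
  assumes "R 11 = 40" "i \<notin> {14, 15}"
  obtains R' where "fold exec_state (mark_code i) (R, w) = (R', w)"
    "R' (40 + R i) = R (40 + R i) + R 12" "agree_off {14, 15, 40 + R i} R' R"
  using assms by (intro that[of "R(14 := 40 + R i, 15 := R (40 + R i) + R 12, 40 + R i := R (40 + R i) + R 12)"])
    (simp_all add: mark_code_def agree_off_def)

text \<open>The two truncated differences of parity and flag add up to their exclusive or, the new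
  parity.\<close>

definition update_code :: "instr list" where
  "update_code = mark_code 4 @ mark_code 5 @
     [Sub 15 0 12, Sub 16 12 0, Add 0 15 16, Add 9 9 3, Add 5 5 2, Sub 13 3 5]"

lemma fold_update_code:
  assumes "layout n E s R" "R 4 = u" "R 5 = v" "R 9 = row n v" "u < n" "v < n"
    and b: "R 12 = of_bool b" "b \<longleftrightarrow> legal E (fst s) u v" and "\<not> E u u"
  obtains R' where "fold exec_state update_code (R, w) = (R', w)"
    "layout n E (play E (u, v) s) R'" "R' 9 = row n (Suc v)" "R' 5 = Suc v" "R' 13 = n - Suc v"
    "R' 4 = R 4" "R' 8 = R 8" "R' 20 = R 20"
proof -
  obtain S p where s: "s = (S, p)"
    by (metis surj_pair)
  have R: "R 3 = n" "R 2 = 1" "R 11 = 40" "R 0 = of_bool p"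
    "\<And>i. i < n \<Longrightarrow> R (40 + i) = of_bool (i \<notin> S)"
    "\<And>i j. i < n \<Longrightarrow> j < n \<Longrightarrow> R (row n i + j) = of_bool (E i j)"
    using assms(1) by (auto simp: layout_def s)
  obtain R1 where R1: "fold exec_state (mark_code 4) (R, w) = (R1, w)"
    "R1 (40 + u) = R (40 + u) + of_bool b" "agree_off {14, 15, 40 + u} R1 R"
    using fold_mark_code[of R 4 w] assms(2) b(1) R(3) by auto
  have "R1 5 = v" "R1 12 = of_bool b" "R1 11 = 40"
    using R1(3) assms(3) b(1) R(3) by (auto simp: agree_off_def)
  then obtain R2 where R2: "fold exec_state (mark_code 5) (R1, w) = (R2, w)"
    "R2 (40 + v) = R1 (40 + v) + of_bool b" "agree_off {14, 15, 40 + v} R2 R1"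
    using fold_mark_code[of R1 5 w] by auto
  have R2R: "R2 k = R k" if "k \<notin> {14, 15, 40 + u, 40 + v}" for k
    using that R1(3) R2(3) by (simp add: agree_off_def)
  define R' where "R' = R2(15 := of_bool p - of_bool b, 16 := of_bool b - of_bool p,
     0 := of_bool (p \<noteq> b), 9 := row n (Suc v), 5 := Suc v, 13 := n - Suc v)"
  have "of_bool p - of_bool b + (of_bool b - of_bool p) = (of_bool (p \<noteq> b) :: nat)"
    by auto
  moreover have "R2 0 = of_bool p" "R2 12 = of_bool b" "R2 9 = row n v" "R2 3 = n" "R2 5 = v" "R2 2 = 1"
    using R R2R assms(3,4) b(1) by auto
  ultimately have "fold exec_state update_code (R, w) = (R', w)"
    by (simp add: update_code_def R1(1) R2(1) R'_def row_Suc)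
  moreover have "layout n E (play E (u, v) s) R'"
  proof -
    have R'R: "R' k = R2 k" if "40 \<le> k" for k
      using that by (simp add: R'_def)
    have "R' 3 = n" "R' 2 = 1" "R' 11 = 40" "R' 0 = of_bool (snd (play E (u, v) s))"
      using R R2R b(2) by (auto simp: R'_def s)
    moreover have "R' (row n i + j) = of_bool (E i j)" if "i < n" "j < n" for i j
    proof -
      have "row n i + j \<noteq> 40 + u" "row n i + j \<noteq> 40 + v" "40 \<le> row n i + j"
        using assms(5,6) by (auto simp: row_def)
      then show ?thesis
        using that R(6) R'R R2R by auto
    qed
    moreover have "R' (40 + i) = of_bool (i \<notin> fst (play E (u, v) s))" if "i < n" for i
    proof (cases b)
      case True
      \<comment> \<open>Distinct endpoints keep both increments from landing in one cell, so the
        entry becomes 1 and not 2.\<close>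
      then have "u \<in> S" "v \<in> S" "u \<noteq> v"
        using b(2) assms(9) by (auto simp: legal_def s)
      moreover have "R1 (40 + v) = R (40 + v)" if "u \<noteq> v"
        using R1(3) that by (simp add: agree_off_def)
      moreover have "R2 (40 + u) = R1 (40 + u)" if "u \<noteq> v"
        using R2(3) that by (simp add: agree_off_def)
      ultimately have "R2 (40 + i) = of_bool (i \<notin> S - {u, v})"
        using R(5)[OF \<open>i < n\<close>] R(5)[OF assms(5)] R(5)[OF assms(6)] R1(2) R2(2) R2R[of "40 + i"] True
        by (cases "i = u"; cases "i = v") auto
      then show ?thesis
        using True b(2) R'R by (simp add: s)
    next
      case False
      have "R2 (40 + i) = R1 (40 + i)"
        using R2(2,3) False by (cases "i = v") (auto simp: agree_off_def)
      moreover have "R1 (40 + i) = R (40 + i)"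
        using R1(2,3) False by (cases "i = u") (auto simp: agree_off_def)
      ultimately show ?thesis
        using False b(2) R'R R(5)[OF \<open>i < n\<close>] by (simp add: s)
    qed
    ultimately show ?thesis
      by (simp add: layout_def)
  qed
  moreover have "R' 9 = row n (Suc v)" "R' 5 = Suc v" "R' 13 = n - Suc v"
    by (simp_all add: R'_def)
  moreover have "R' 4 = R 4" "R' 8 = R 8" "R' 20 = R 20"
    using R2R by (simp_all add: R'_def)
  ultimately show thesis
    using that by blast
qed

text \<open>Vertices outside \<open>S\<close> are harmless, so the test may range over all numbers
  below \<open>n\<close>.\<close>

lemma legal_iff_harmless:
  assumes "S \<subseteq> {..<n}"
  shows "legal E S u v \<longleftrightarrow> (u \<in> S \<and> v \<in> S \<and> E u v) \<and> (\<forall>x<n. \<forall>y<n. harmless E S u v x y)"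
  using assms unfolding legal_def harmless_def by (auto dest: subsetD)

text \<open>The part of the legality test that is decided before the pair \<open>(x, y)\<close> is
  inspected.\<close>

definition flag :: "nat \<Rightarrow> (nat \<Rightarrow> nat \<Rightarrow> bool) \<Rightarrow> nat set \<Rightarrow> nat \<Rightarrow> nat \<Rightarrow> nat \<Rightarrow> nat \<Rightarrow> bool" where
  "flag n E S u v x y \<longleftrightarrow> (u \<in> S \<and> v \<in> S \<and> E u v)
     \<and> (\<forall>x'<x. \<forall>y'<n. harmless E S u v x' y') \<and> (\<forall>y'<y. harmless E S u v x y')"

lemma flag_Suc: "flag n E S u v x (Suc y) \<longleftrightarrow> flag n E S u v x y \<and> harmless E S u v x y"
  by (auto simp: flag_def less_Suc_eq)

lemma flag_end: "flag n E S u v (Suc x) 0 \<longleftrightarrow> flag n E S u v x n"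
  by (auto simp: flag_def less_Suc_eq)

section \<open>Loop invariants and nested loops\<close>

definition state_at :: "nat \<Rightarrow> (nat \<Rightarrow> nat \<Rightarrow> bool) \<Rightarrow> nat \<Rightarrow> nat \<Rightarrow> nat \<Rightarrow> nat set \<times> bool" where
  "state_at n E k u v = fold (play E) (pairs_below n u v) (sweeps E n k)"

lemma state_at_Suc: "state_at n E k u (Suc v) = play E (u, v) (state_at n E k u v)"
  by (simp add: state_at_def pairs_below_Suc)

lemma state_at_end: "state_at n E k (Suc u) 0 = state_at n E k u n"
  by (simp add: state_at_def pairs_below_end)

lemma state_at_start: "state_at n E k 0 0 = sweeps E n k"
  by (simp add: state_at_def pairs_below_start)

lemma state_at_sweep: "state_at n E k n 0 = sweeps E n (Suc k)"
  by (simp add: state_at_def sweeps_def)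

text \<open>The invariants mirror the nesting of the loops: what an inner loop establishes at its
  final index \<open>n\<close> is, by the \<open>_end\<close> and \<open>_sweep\<close> equations,
  the outer invariant at the next index.\<close>

definition inv_sweep :: "nat \<Rightarrow> (nat \<Rightarrow> nat \<Rightarrow> bool) \<Rightarrow> nat \<Rightarrow> assertion" where
  "inv_sweep n E k R w \<longleftrightarrow> layout n E (sweeps E n k) R \<and> R 20 = k"

definition inv_row :: "nat \<Rightarrow> (nat \<Rightarrow> nat \<Rightarrow> bool) \<Rightarrow> nat \<Rightarrow> nat \<Rightarrow> assertion" where
  "inv_row n E k u R w \<longleftrightarrow> layout n E (state_at n E k u 0) R \<and> R 20 = k \<and> R 4 = u \<and> R 8 = row n u"

definition inv_pair :: "nat \<Rightarrow> (nat \<Rightarrow> nat \<Rightarrow> bool) \<Rightarrow> nat \<Rightarrow> nat \<Rightarrow> nat \<Rightarrow> assertion" where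
  "inv_pair n E k u v R w \<longleftrightarrow> layout n E (state_at n E k u v) R \<and> R 20 = k \<and> R 4 = u \<and> R 8 = row n u
     \<and> R 5 = v \<and> R 9 = row n v"

definition inv_test :: "nat \<Rightarrow> (nat \<Rightarrow> nat \<Rightarrow> bool) \<Rightarrow> nat \<Rightarrow> nat \<Rightarrow> nat \<Rightarrow> nat \<Rightarrow> assertion" where
  "inv_test n E k u v x R w \<longleftrightarrow> inv_pair n E k u v R w \<and> R 6 = x \<and> R 10 = row n x
     \<and> R 12 = of_bool (flag n E (fst (state_at n E k u v)) u v x 0)"

definition inv_cell :: "nat \<Rightarrow> (nat \<Rightarrow> nat \<Rightarrow> bool) \<Rightarrow> nat \<Rightarrow> nat \<Rightarrow> nat \<Rightarrow> nat \<Rightarrow> nat \<Rightarrow> assertion" where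
  "inv_cell n E k u v x y R w \<longleftrightarrow> inv_pair n E k u v R w \<and> R 6 = x \<and> R 10 = row n x \<and> R 7 = y
     \<and> R 12 = of_bool (flag n E (fst (state_at n E k u v)) u v x y)"

lemma layout_agree_off:
  assumes "layout n E s R" "agree_off K R' R" "K \<subseteq> scratch"
  shows "layout n E s R'"
  using assms by (intro layout_cong[OF assms(1)]) (auto simp: agree_off_def)

lemma inv_pair_agree_off:
  assumes "inv_pair n E k u v R w" "agree_off K R' R" "K \<subseteq> {6, 7, 10, 12, 13, 14, 15, 16}"
  shows "inv_pair n E k u v R' w'"
proof -
  have "K \<subseteq> scratch" "20 \<notin> K" "4 \<notin> K" "8 \<notin> K" "5 \<notin> K" "9 \<notin> K"
    using assms(3) by (auto simp: scratch_def)
  then show ?thesis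
    using assms(1,2) layout_agree_off[of n E _ R K R'] by (simp add: inv_pair_def agree_off_def)
qed

definition cell_loop :: com where
  "cell_loop = DoWhile (Straight cell_code) 13"

definition test_loop :: com where
  "test_loop = DoWhile (Straight [Const 7 0] ;; cell_loop ;; Straight [Add 10 10 3, Add 6 6 2, Sub 13 3 6]) 13"

definition pair_loop :: com where
  "pair_loop = DoWhile (Straight guard_code ;; test_loop ;; Straight update_code) 13"

definition row_loop :: com where
  "row_loop = DoWhile (Straight [Const 5 0, Add 9 11 3] ;; pair_loop ;;
     Straight [Add 8 8 3, Add 4 4 2, Sub 13 3 4]) 13"

definition sweep_loop :: com where
  "sweep_loop = DoWhile (Straight [Const 4 0, Add 8 11 3] ;; row_loop ;;
     Straight [Add 20 20 2, Sub 13 3 20]) 13"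

lemma straight_codes:
  "\<forall>i\<in>set cell_code. \<not> is_jump i" "\<forall>i\<in>set guard_code. \<not> is_jump i" "\<forall>i\<in>set update_code. \<not> is_jump i"
  by (simp_all add: cell_code_def harmless_code_def count_load_def count_eq_def count_nonadjacent_def
      guard_code_def update_code_def mark_code_def)

text \<open>In this and the following bounds, the rounds are multiplied by the cost of the body plus
  one jump. The outermost bound has order \<open>n ^ 5\<close>.\<close>

definition cell_time :: "nat \<Rightarrow> nat" where
  "cell_time n = n * (length cell_code + 1)"

definition test_time :: "nat \<Rightarrow> nat" where
  "test_time n = n * (1 + (cell_time n + 3) + 1)"

definition pair_time :: "nat \<Rightarrow> nat" where
  "pair_time n = n * (length guard_code + (test_time n + length update_code) + 1)"

definition row_time :: "nat \<Rightarrow> nat" where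
  "row_time n = n * (2 + (pair_time n + 3) + 1)"

definition sweep_time :: "nat \<Rightarrow> nat" where
  "sweep_time n = n * (2 + (row_time n + 2) + 1)"

context
  fixes n :: nat and E :: "nat \<Rightarrow> nat \<Rightarrow> bool"
  assumes E: "symp E" "irreflp E" and n: "0 < n"
begin

lemma hoare_cell_loop:
  assumes "u < n" "v < n" "x < n"
  shows "hoare (inv_cell n E k u v x 0) cell_loop (cell_time n) (inv_cell n E k u v x n)"
  unfolding cell_loop_def cell_time_def
proof (rule hoare_DoWhile[OF _ n], rule hoare_Straight[OF straight_codes(1)])
  fix y R w assume "y < n" and R: "inv_cell n E k u v x y R w"
  let ?s = "state_at n E k u v"
  have pre: "layout n E ?s R" "R 4 = u" "R 5 = v" "R 6 = x" "R 7 = y" "u < n" "v < n" "x < n" "y < n"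
    "R 8 = row n u" "R 9 = row n v" "R 10 = row n x" "R 12 = of_bool (flag n E (fst ?s) u v x y)"
    using R assms \<open>y < n\<close> by (simp_all add: inv_cell_def inv_pair_def)
  obtain R' where R': "fold exec_state cell_code (R, w) = (R', w)"
    "R' 12 = of_bool (flag n E (fst ?s) u v x y \<and> harmless E (fst ?s) u v x y)"
    "R' 7 = Suc y" "R' 13 = n - Suc y" "agree_off {7, 12, 13, 14, 15, 16} R' R"
    by (rule fold_cell_code[OF pre])
  have "inv_pair n E k u v R' w"
    using R R'(5) by - (rule inv_pair_agree_off[of _ _ _ _ _ R w],
        auto simp: inv_cell_def)
  moreover have "R' 6 = x" "R' 10 = row n x"
    using R R'(5) by (auto simp: inv_cell_def agree_off_def)
  ultimately have "inv_cell n E k u v x (Suc y) R' w"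
    using R'(2,3) by (simp add: inv_cell_def flag_Suc)
  then show "\<exists>R' w'. fold exec_state cell_code (R, w) = (R', w') \<and>
      inv_cell n E k u v x (Suc y) R' w' \<and> (0 < R' 13 \<longleftrightarrow> Suc y < n)"
    using R'(1,4) by auto
qed

lemma hoare_test_loop:
  assumes "u < n" "v < n"
  shows "hoare (inv_test n E k u v 0) test_loop (test_time n) (inv_test n E k u v n)"
  unfolding test_loop_def test_time_def
proof (rule hoare_DoWhile[OF _ n])
  fix x assume "x < n"
  have 1: "hoare (inv_test n E k u v x) (Straight [Const 7 0]) 1 (inv_cell n E k u v x 0)"
  proof (rule hoare_conseq[OF hoare_Straight[where A = "inv_test n E k u v x" and B = "inv_cell n E k u v x 0"]])
    fix R w assume R: "inv_test n E k u v x R w"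
    have "inv_pair n E k u v (R(7 := 0)) w"
      using R by - (rule inv_pair_agree_off[of _ _ _ _ _ R w "{7}"],
        auto simp: inv_test_def agree_off_def)
    then have "inv_cell n E k u v x 0 (R(7 := 0)) w"
      using R by (simp add: inv_test_def inv_cell_def)
    then show "\<exists>R' w'. fold exec_state [Const 7 0] (R, w) = (R', w') \<and> inv_cell n E k u v x 0 R' w'"
      by simp
  qed auto
  have 3: "hoare (inv_cell n E k u v x n) (Straight [Add 10 10 3, Add 6 6 2, Sub 13 3 6]) 3
      (\<lambda>R w. inv_test n E k u v (Suc x) R w \<and> (0 < R 13 \<longleftrightarrow> Suc x < n))" (is "hoare ?A (Straight ?c) 3 ?B")
  proof (rule hoare_conseq[OF hoare_Straight[where A = ?A and B = ?B]])
    fix R w assume R: "?A R w"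
    then have "R 3 = n" "R 2 = 1"
      by (auto simp: inv_cell_def inv_pair_def layout_def)
    moreover define R' where "R' = R(10 := row n (Suc x), 6 := Suc x, 13 := n - Suc x)"
    ultimately have "fold exec_state ?c (R, w) = (R', w)"
      using R by (simp add: inv_cell_def row_Suc)
    moreover have "inv_pair n E k u v R' w"
      using R by - (rule inv_pair_agree_off[of _ _ _ _ _ R w "{10, 6, 13}"],
        auto simp: inv_cell_def agree_off_def R'_def)
    then have "?B R' w"
      using R by (auto simp: inv_test_def R'_def inv_cell_def flag_end)
    ultimately show "\<exists>R' w'. fold exec_state ?c (R, w) = (R', w') \<and> ?B R' w'"
      by (intro exI[of _ R'] exI[of _ w]) simp
  qed auto
  show "hoare (inv_test n E k u v x)
      (Straight [Const 7 0] ;; cell_loop ;; Straight [Add 10 10 3, Add 6 6 2, Sub 13 3 6])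
      (1 + (cell_time n + 3)) (\<lambda>R w. inv_test n E k u v (Suc x) R w \<and> (0 < R 13 \<longleftrightarrow> Suc x < n))"
    by (rule hoare_Seq[OF 1 hoare_Seq[OF hoare_cell_loop[OF assms \<open>x < n\<close>] 3]])
qed

text \<open>One round performs one \<open>play\<close>: guard and test compute legality into
  register 12, and the update applies it.\<close>

lemma hoare_pair_loop:
  assumes "u < n"
  shows "hoare (inv_pair n E k u 0) pair_loop (pair_time n) (inv_pair n E k u n)"
  unfolding pair_loop_def pair_time_def
proof (rule hoare_DoWhile[OF _ n])
  fix v assume "v < n"
  let ?s = "state_at n E k u v"
  have S: "fst ?s \<subseteq> {..<n}"
    unfolding state_at_def
    by (rule order_trans[OF fst_fold_play_subset sweeps_invariant[OF E, THEN conjunct1]])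
  have 1: "hoare (inv_pair n E k u v) (Straight guard_code) (length guard_code) (inv_test n E k u v 0)"
  proof (rule hoare_Straight[OF straight_codes(2)])
    fix R w assume R: "inv_pair n E k u v R w"
    have pre: "layout n E ?s R" "R 4 = u" "R 5 = v" "u < n" "v < n" "R 8 = row n u"
      using R assms \<open>v < n\<close> by (simp_all add: inv_pair_def)
    obtain R' where R': "fold exec_state guard_code (R, w) = (R', w)"
      "R' 12 = of_bool (u \<in> fst ?s \<and> v \<in> fst ?s \<and> E u v)" "R' 6 = 0" "R' 10 = row n 0"
      "agree_off {6, 10, 12, 14, 15, 16} R' R"
      by (rule fold_guard_code[OF pre])
    have "inv_pair n E k u v R' w"
      using R R'(5) by - (rule inv_pair_agree_off[of _ _ _ _ _ R w], auto)
    then have "inv_test n E k u v 0 R' w"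
      using R'(2-4) by (simp add: inv_test_def flag_def)
    then show "\<exists>R' w'. fold exec_state guard_code (R, w) = (R', w') \<and> inv_test n E k u v 0 R' w'"
      using R'(1) by blast
  qed
  have 3: "hoare (inv_test n E k u v n) (Straight update_code) (length update_code)
      (\<lambda>R w. inv_pair n E k u (Suc v) R w \<and> (0 < R 13 \<longleftrightarrow> Suc v < n))" (is "hoare _ _ _ ?B")
  proof (rule hoare_Straight[OF straight_codes(3)])
    fix R w assume R: "inv_test n E k u v n R w"
    have legal: "flag n E (fst ?s) u v n 0 \<longleftrightarrow> legal E (fst ?s) u v"
      unfolding legal_iff_harmless[OF S] by (simp add: flag_def)
    have pre: "layout n E ?s R" "R 4 = u" "R 5 = v" "R 9 = row n v" "u < n" "v < n"
      "R 12 = of_bool (flag n E (fst ?s) u v n 0)"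
      using R assms \<open>v < n\<close> by (simp_all add: inv_test_def inv_pair_def)
    have "\<not> E u u"
      using E(2) by (simp add: irreflp_def)
    then obtain R' where "fold exec_state update_code (R, w) = (R', w)"
      "layout n E (play E (u, v) ?s) R'" "R' 9 = row n (Suc v)" "R' 5 = Suc v" "R' 13 = n - Suc v"
      "R' 4 = R 4" "R' 8 = R 8" "R' 20 = R 20"
      by (rule fold_update_code[OF pre legal])
    then show "\<exists>R' w'. fold exec_state update_code (R, w) = (R', w') \<and> ?B R' w'"
      using pre R by (auto simp: inv_test_def inv_pair_def state_at_Suc)
  qed
  show "hoare (inv_pair n E k u v) (Straight guard_code ;; test_loop ;; Straight update_code)
      (length guard_code + (test_time n + length update_code)) ?B"
    by (rule hoare_Seq[OF 1 hoare_Seq[OF hoare_test_loop[OF assms \<open>v < n\<close>] 3]])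
qed

lemma hoare_row_loop:
  "hoare (inv_row n E k 0) row_loop (row_time n) (inv_row n E k n)"
  unfolding row_loop_def row_time_def
proof (rule hoare_DoWhile[OF _ n])
  fix u assume "u < n"
  let ?c = "[Const 5 0, Add 9 11 3]" and ?d = "[Add 8 8 3, Add 4 4 2, Sub 13 3 4]"
  let ?B = "\<lambda>R w. inv_row n E k (Suc u) R w \<and> (0 < R 13 \<longleftrightarrow> Suc u < n)"
  have 1: "hoare (inv_row n E k u) (Straight ?c) 2 (inv_pair n E k u 0)"
  proof (rule hoare_conseq[OF hoare_Straight[where A = "inv_row n E k u" and B = "inv_pair n E k u 0"]])
    fix R w assume R: "inv_row n E k u R w"
    define R' where "R' = R(5 := 0, 9 := row n 0)"
    have "fold exec_state ?c (R, w) = (R', w)"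
      using R by (simp add: R'_def inv_row_def layout_def row_0)
    moreover have "layout n E (state_at n E k u 0) R'"
      using R by - (rule layout_agree_off[where R = R and K = "{5, 9}"],
        auto simp: inv_row_def agree_off_def R'_def scratch_def)
    then have "inv_pair n E k u 0 R' w"
      using R by (simp add: inv_pair_def inv_row_def R'_def)
    ultimately show "\<exists>R' w'. fold exec_state ?c (R, w) = (R', w') \<and> inv_pair n E k u 0 R' w'"
      by blast
  qed auto
  have 3: "hoare (inv_pair n E k u n) (Straight ?d) 3 ?B"
  proof (rule hoare_conseq[OF hoare_Straight[where A = "inv_pair n E k u n" and B = ?B]])
    fix R w assume R: "inv_pair n E k u n R w"
    define R' where "R' = R(8 := row n (Suc u), 4 := Suc u, 13 := n - Suc u)"
    have "fold exec_state ?d (R, w) = (R', w)"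
      using R by (simp add: R'_def inv_pair_def layout_def row_Suc)
    moreover have "layout n E (state_at n E k (Suc u) 0) R'"
      using R unfolding state_at_end by - (rule layout_agree_off[where R = R and K = "{8, 4, 13}"],
        auto simp: inv_pair_def agree_off_def R'_def scratch_def)
    then have "?B R' w"
      using R by (auto simp: inv_row_def inv_pair_def R'_def)
    ultimately show "\<exists>R' w'. fold exec_state ?d (R, w) = (R', w') \<and> ?B R' w'"
      by (intro exI[of _ R'] exI[of _ w]) simp
  qed auto
  show "hoare (inv_row n E k u) (Straight ?c ;; pair_loop ;; Straight ?d) (2 + (pair_time n + 3)) ?B"
    by (rule hoare_Seq[OF 1 hoare_Seq[OF hoare_pair_loop[OF \<open>u < n\<close>] 3]])
qed

lemma hoare_sweep_loop:
  "hoare (inv_sweep n E 0) sweep_loop (sweep_time n) (inv_sweep n E n)"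
  unfolding sweep_loop_def sweep_time_def
proof (rule hoare_DoWhile[OF _ n])
  fix k assume "k < n"
  let ?c = "[Const 4 0, Add 8 11 3]" and ?d = "[Add 20 20 2, Sub 13 3 20]"
  let ?B = "\<lambda>R w. inv_sweep n E (Suc k) R w \<and> (0 < R 13 \<longleftrightarrow> Suc k < n)"
  have 1: "hoare (inv_sweep n E k) (Straight ?c) 2 (inv_row n E k 0)"
  proof (rule hoare_conseq[OF hoare_Straight[where A = "inv_sweep n E k" and B = "inv_row n E k 0"]])
    fix R w assume R: "inv_sweep n E k R w"
    define R' where "R' = R(4 := 0, 8 := row n 0)"
    have "fold exec_state ?c (R, w) = (R', w)"
      using R by (simp add: R'_def inv_sweep_def layout_def row_0)
    moreover have "layout n E (state_at n E k 0 0) R'"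
      using R unfolding state_at_start by - (rule layout_agree_off[where R = R and K = "{4, 8}"],
        auto simp: inv_sweep_def agree_off_def R'_def scratch_def)
    then have "inv_row n E k 0 R' w"
      using R by (simp add: inv_sweep_def inv_row_def R'_def)
    ultimately show "\<exists>R' w'. fold exec_state ?c (R, w) = (R', w') \<and> inv_row n E k 0 R' w'"
      by blast
  qed auto
  have 3: "hoare (inv_row n E k n) (Straight ?d) 2 ?B"
  proof (rule hoare_conseq[OF hoare_Straight[where A = "inv_row n E k n" and B = ?B]])
    fix R w assume R: "inv_row n E k n R w"
    define R' where "R' = R(20 := Suc k, 13 := n - Suc k)"
    have "fold exec_state ?d (R, w) = (R', w)"
      using R by (simp add: R'_def inv_row_def layout_def)
    moreover have "layout n E (sweeps E n (Suc k)) R'"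
      using R unfolding state_at_sweep[symmetric] by - (rule layout_agree_off[where R = R and K = "{20, 13}"],
        auto simp: inv_row_def agree_off_def R'_def scratch_def)
    then have "?B R' w"
      by (auto simp: inv_sweep_def R'_def)
    ultimately show "\<exists>R' w'. fold exec_state ?d (R, w) = (R', w') \<and> ?B R' w'"
      by (intro exI[of _ R'] exI[of _ w]) simp
  qed auto
  show "hoare (inv_sweep n E k) (Straight ?c ;; row_loop ;; Straight ?d) (2 + (row_time n + 2)) ?B"
    by (rule hoare_Seq[OF 1 hoare_Seq[OF hoare_row_loop 3]])
qed

end

section \<open>Reading the input\<close>

definition size_loop :: com where
  "size_loop = DoWhile (Straight [Read 13, Add 3 3 13]) 13"

lemma hoare_size_loop:
  "hoare (\<lambda>R w. R = (\<lambda>_. 0) \<and> w = replicate n True @ False # ws) size_loop (Suc n * 3)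
     (\<lambda>R w. R 3 = n \<and> (\<forall>k. k \<noteq> 3 \<and> k \<noteq> 13 \<longrightarrow> R k = 0) \<and> w = ws)"
proof -
  let ?c = "[Read 13, Add 3 3 13]"
  \<comment> \<open>The last round reads the separator 0, adds it without effect and thereby ends
    the loop; hence \<open>Suc n\<close> rounds and \<open>min i n\<close>.\<close>
  define I where "I i R w \<longleftrightarrow> R 3 = min i n \<and> (\<forall>k. k \<noteq> 3 \<and> k \<noteq> 13 \<longrightarrow> R k = 0)
      \<and> w = drop i (replicate n True @ False # ws)" for i :: nat and R :: "nat \<Rightarrow> nat" and w
  have "hoare (I 0) (DoWhile (Straight ?c) 13) (Suc n * (2 + 1)) (I (Suc n))"
  proof (rule hoare_DoWhile)
    fix i assume "i < Suc n"
    let ?B = "\<lambda>R w. I (Suc i) R w \<and> (0 < R 13 \<longleftrightarrow> Suc i < Suc n)"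
    show "hoare (I i) (Straight ?c) 2 ?B"
    proof (rule hoare_conseq[OF hoare_Straight[where A = "I i" and B = ?B]])
      fix R w assume R: "I i R w"
      have "w = (i < n) # drop (Suc i) (replicate n True @ False # ws)"
        using R \<open>i < Suc n\<close> Cons_nth_drop_Suc[of i "replicate n True @ False # ws"]
        by (auto simp: I_def nth_append less_Suc_eq)
      moreover define R' where "R' = R(13 := of_bool (i < n), 3 := min (Suc i) n)"
      ultimately have "fold exec_state ?c (R, w) = (R', drop (Suc i) (replicate n True @ False # ws))"
        using R \<open>i < Suc n\<close> by (cases "i = n") (simp_all add: I_def)
      moreover have "?B R' (drop (Suc i) (replicate n True @ False # ws))"
        using R \<open>i < Suc n\<close> by (simp add: I_def R'_def)
      ultimately show "\<exists>R' w'. fold exec_state ?c (R, w) = (R', w') \<and> ?B R' w'"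
        by (intro exI[of _ R'] exI) (rule conjI)
    qed auto
  qed simp
  then show ?thesis
    unfolding size_loop_def by (rule hoare_conseq) (auto simp: I_def)
qed

text \<open>The matrix arrives and is stored row by row, so the pointer in register 8 merely
  advances. Nested counters spare the product \<open>n * n\<close> on a machine without
  multiplication.\<close>

definition entry_loop :: com where
  "entry_loop = DoWhile (Straight [Read 13, Store 8 13, Add 8 8 2, Add 5 5 2, Sub 13 3 5]) 13"

definition matrix_loop :: com where
  "matrix_loop = DoWhile (Straight [Const 5 0] ;; entry_loop ;; Straight [Add 4 4 2, Sub 13 3 4]) 13"

definition matrix_time :: "nat \<Rightarrow> nat" where
  "matrix_time n = n * (1 + (n * (5 + 1) + 2) + 1)"

text \<open>The cells from 40 to \<open>39 + n\<close> are not written while reading: their initial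
  0 already says that no vertex has been removed.\<close>

definition inv_read :: "nat \<Rightarrow> bool list \<Rightarrow> nat \<Rightarrow> nat \<Rightarrow> assertion" where
  "inv_read n ws i m R w \<longleftrightarrow> R 3 = n \<and> R 2 = 1 \<and> R 11 = 40 \<and> R 0 = 0 \<and> R 20 = 0 \<and> R 4 = i
     \<and> R 8 = 40 + n + m \<and> (\<forall>k<n. R (40 + k) = 0) \<and> (\<forall>k<m. R (40 + n + k) = of_bool (ws ! k))
     \<and> w = drop m ws"

lemma hoare_entry_loop:
  assumes "0 < n" "i < n" "length ws = n * n"
  shows "hoare (\<lambda>R w. inv_read n ws i (i * n) R w \<and> R 5 = 0) entry_loop (n * (5 + 1))
    (inv_read n ws i (i * n + n))"
proof -
  let ?c = "[Read 13, Store 8 13, Add 8 8 2, Add 5 5 2, Sub 13 3 5]"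
  define I where "I j R w \<longleftrightarrow> inv_read n ws i (i * n + j) R w \<and> R 5 = j" for j :: nat and R :: "nat \<Rightarrow> nat" and w
  have "hoare (I 0) (DoWhile (Straight ?c) 13) (n * (5 + 1)) (I n)"
  proof (rule hoare_DoWhile[OF _ assms(1)])
    fix j assume "j < n"
    let ?m = "i * n + j"
    let ?B = "\<lambda>R w. I (Suc j) R w \<and> (0 < R 13 \<longleftrightarrow> Suc j < n)"
    show "hoare (I j) (Straight ?c) 5 ?B"
    proof (rule hoare_conseq[OF hoare_Straight[where A = "I j" and B = ?B]])
      fix R w assume R: "I j R w"
      have "?m < Suc i * n"
        using \<open>j < n\<close> by simp
      also have "\<dots> \<le> length ws"
        unfolding assms(3) using assms(2) by (intro mult_right_mono) auto
      finally have w: "w = ws ! ?m # drop (Suc ?m) ws"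
        using R Cons_nth_drop_Suc[of ?m ws] by (simp add: I_def inv_read_def)
      define R' where "R' = R(40 + n + ?m := of_bool (ws ! ?m), 8 := 40 + n + Suc ?m, 5 := Suc j, 13 := n - Suc j)"
      have "fold exec_state ?c (R, w) = (R', drop (Suc ?m) ws)"
      proof -
        have "R 8 = 40 + n + ?m" "R 3 = n" "R 2 = 1" "R 5 = j"
          using R by (simp_all add: I_def inv_read_def)
        then show ?thesis
          unfolding w R'_def by (auto simp: fun_eq_iff)
      qed
      moreover have "R' (40 + n + k) = of_bool (ws ! k)" if "k < Suc ?m" for k
        using R that by (auto simp: R'_def I_def inv_read_def less_Suc_eq)
      then have "?B R' (drop (Suc ?m) ws)"
        using R by (auto simp: I_def inv_read_def R'_def)
      ultimately show "\<exists>R' w'. fold exec_state ?c (R, w) = (R', w') \<and> ?B R' w'"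
        by (intro exI[of _ R'] exI) (rule conjI)
    qed auto
  qed
  then show ?thesis
    unfolding entry_loop_def by (rule hoare_conseq) (auto simp: I_def)
qed

lemma hoare_matrix_loop:
  assumes "0 < n" "length ws = n * n"
  shows "hoare (inv_read n ws 0 0) matrix_loop (matrix_time n) (inv_read n ws n (n * n))"
proof -
  let ?d = "[Add 4 4 2, Sub 13 3 4]"
  have "hoare (inv_read n ws 0 (0 * n)) matrix_loop (matrix_time n) (inv_read n ws n (n * n))"
    unfolding matrix_loop_def matrix_time_def
  proof (rule hoare_DoWhile[where I = "\<lambda>i. inv_read n ws i (i * n)", OF _ assms(1)])
    fix i assume "i < n"
    let ?A = "inv_read n ws i (i * n)" and ?C = "inv_read n ws i (i * n + n)"
    let ?B = "\<lambda>R w. inv_read n ws (Suc i) (Suc i * n) R w \<and> (0 < R 13 \<longleftrightarrow> Suc i < n)"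
    have 1: "hoare ?A (Straight [Const 5 0]) 1 (\<lambda>R w. ?A R w \<and> R 5 = 0)"
      by (rule hoare_conseq[OF hoare_Straight[where A = ?A and B = "\<lambda>R w. ?A R w \<and> R 5 = 0"]])
        (auto simp: inv_read_def)
    have 3: "hoare ?C (Straight ?d) 2 ?B"
      by (rule hoare_conseq[OF hoare_Straight[where A = ?C and B = ?B]])
        (auto simp: inv_read_def add.commute)
    show "hoare ?A (Straight [Const 5 0] ;; entry_loop ;; Straight ?d) (1 + (n * (5 + 1) + 2)) ?B"
      by (rule hoare_Seq[OF 1 hoare_Seq[OF hoare_entry_loop[OF assms(1) \<open>i < n\<close> assms(2)] 3]])
  qed
  then show ?thesis
    by simp
qed

definition program :: com where
  "program = size_loop ;; Straight [Const 2 1, Const 11 40, Add 8 11 3] ;; matrix_loop ;; sweep_loop"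

definition program_time :: "nat \<Rightarrow> nat" where
  "program_time n = Suc n * 3 + (3 + (matrix_time n + sweep_time n))"

lemma hoare_program:
  assumes "symp E" "irreflp E" "0 < n" "length ws = n * n"
    and ws: "\<And>i j. i < n \<Longrightarrow> j < n \<Longrightarrow> ws ! (i * n + j) = E i j"
  shows "hoare (\<lambda>R w. R = (\<lambda>_. 0) \<and> w = replicate n True @ False # ws) program (program_time n)
    (\<lambda>R w. R 0 = of_bool (wins E {..<n}))"
proof -
  let ?c = "[Const 2 1, Const 11 40, Add 8 11 3]"
  let ?A = "\<lambda>R w. R 3 = n \<and> (\<forall>k. k \<noteq> 3 \<and> k \<noteq> 13 \<longrightarrow> R k = 0) \<and> w = ws"
  have 2: "hoare ?A (Straight ?c) 3 (inv_read n ws 0 0)"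
    by (rule hoare_conseq[OF hoare_Straight[where A = ?A and B = "inv_read n ws 0 0"]])
      (auto simp: inv_read_def)
  have 3: "hoare (inv_read n ws 0 0) matrix_loop (matrix_time n) (inv_sweep n E 0)"
  proof (rule hoare_conseq[OF hoare_matrix_loop[OF assms(3,4)]])
    fix R w assume R: "inv_read n ws n (n * n) R w"
    have "R (row n i + j) = of_bool (E i j)" if "i < n" "j < n" for i j
    proof -
      have "i * n + j < Suc i * n"
        using that by simp
      also have "\<dots> \<le> n * n"
        using that by (intro mult_right_mono) auto
      finally have "R (40 + n + (i * n + j)) = of_bool (ws ! (i * n + j))"
        using R by (simp only: inv_read_def)
      then show ?thesis
        using ws[OF that] by (simp add: row_def add.assoc)
    qed
    then show "inv_sweep n E 0 R w"
      using R by (simp add: inv_sweep_def layout_def inv_read_def sweeps_def)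
  qed auto
  have 4: "hoare (inv_sweep n E 0) sweep_loop (sweep_time n) (\<lambda>R w. R 0 = of_bool (wins E {..<n}))"
    by (rule hoare_conseq[OF hoare_sweep_loop[OF assms(1-3)]])
      (simp_all add: inv_sweep_def layout_def snd_sweeps[OF assms(1,2)])
  show ?thesis
    unfolding program_def program_time_def by (rule hoare_Seq[OF hoare_size_loop hoare_Seq[OF 2 hoare_Seq[OF 3 4]]])
qed

section \<open>Matrix words, polynomial bounds and the final assembly\<close>

lemma length_concat_rows: "length (concat (map (\<lambda>i. map (f i) [0..<n]) [0..<m])) = m * n"
  by (induction m) auto

lemma nth_concat_rows:
  assumes "i < m" "j < n"
  shows "concat (map (\<lambda>i. map (f i) [0..<n]) [0..<m]) ! (i * n + j) = f i j"
  using assms(1)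
proof (induction m)
  case (Suc m)
  show ?case
  proof (cases "i < m")
    case True
    have "i * n + j < Suc i * n"
      using assms(2) by simp
    also have "\<dots> \<le> m * n"
      using True by (intro mult_right_mono) auto
    finally show ?thesis
      using Suc.IH True by (simp add: nth_append length_concat_rows)
  next
    case False
    then have "i = m"
      using Suc.prems by simp
    then show ?thesis
      using assms(2) by (simp add: nth_append length_concat_rows)
  qed
qed simp

text \<open>Closure rules stand in for writing out the polynomial of the nested time bounds.\<close>

definition polynomial_function :: "(nat \<Rightarrow> nat) \<Rightarrow> bool" where
  "polynomial_function f \<longleftrightarrow> (\<exists>p. \<forall>n. f n = poly p n)"

lemma polynomial_function_intros:
  "polynomial_function (\<lambda>n. c)"
  "polynomial_function (\<lambda>n. n)"
  "polynomial_function f \<Longrightarrow> polynomial_function (\<lambda>n. Suc (f n))"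
  "polynomial_function f \<Longrightarrow> polynomial_function g \<Longrightarrow> polynomial_function (\<lambda>n. f n + g n)"
  "polynomial_function f \<Longrightarrow> polynomial_function g \<Longrightarrow> polynomial_function (\<lambda>n. f n * g n)"
proof -
  show "polynomial_function (\<lambda>n. c)"
    unfolding polynomial_function_def by (rule exI[of _ "[:c:]"]) simp
  show "polynomial_function (\<lambda>n. n)"
    unfolding polynomial_function_def by (rule exI[of _ "[:0, 1:]"]) simp
  show "polynomial_function (\<lambda>n. Suc (f n))" if f: "polynomial_function f"
  proof -
    obtain p where "\<forall>n. f n = poly p n"
      using f by (auto simp: polynomial_function_def)
    then show ?thesis
      unfolding polynomial_function_def by (intro exI[of _ "p + 1"]) simp
  qed
  show "polynomial_function (\<lambda>n. f n + g n)" "polynomial_function (\<lambda>n. f n * g n)"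
    if fg: "polynomial_function f" "polynomial_function g"
  proof -
    obtain p q where pq: "\<forall>n. f n = poly p n" "\<forall>n. g n = poly q n"
      using fg by (auto simp: polynomial_function_def)
    show "polynomial_function (\<lambda>n. f n + g n)"
      unfolding polynomial_function_def by (intro exI[of _ "p + q"]) (simp add: pq)
    show "polynomial_function (\<lambda>n. f n * g n)"
      unfolding polynomial_function_def by (intro exI[of _ "p * q"]) (simp add: pq)
  qed
qed

lemma answers_within_mono: "answers_within P w T b \<Longrightarrow> T \<le> U \<Longrightarrow> answers_within P w U b"
  unfolding answers_within_def by (meson order_trans)

text \<open>Natural coefficients make the bound monotone, so it passes from the number of vertices
  to the longer input word.\<close>

lemma poly_nat_mono: "n \<le> m \<Longrightarrow> poly p n \<le> poly p m" for p :: "nat poly"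
  by (induction p) (auto intro!: mult_mono)

lemma polynomial_program_time: "polynomial_function program_time"
  unfolding program_time_def[abs_def] matrix_time_def sweep_time_def row_time_def pair_time_def
    test_time_def cell_time_def
  by (intro polynomial_function_intros)

theorem theorem7:
  shows "poly_time_decidable_on
    {G :: nat pair_pre_digraph. clique_tree (with_proj G) \<and> (\<exists>n. pverts G = {..<n})}
    graph_word
    (\<lambda>G. first_player_wins (with_proj G))"
proof -
  obtain p where p: "\<And>n. program_time n = poly p n"
    using polynomial_program_time by (auto simp: polynomial_function_def)
  have "answers_within (compile 0 program) (graph_word G) (poly p (length (graph_word G)))
      (first_player_wins (with_proj G))"
    if G: "clique_tree (with_proj G)" and n: "pverts G = {..<n}" for G :: "nat pair_pre_digraph" and n
  proof -
    define E where "E = dominates (with_proj G)"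
    define ws where "ws = concat (map (\<lambda>u. map (\<lambda>v. (u, v) \<in> parcs G) [0..<n]) [0..<n])"
    have E: "E = (\<lambda>u v. (u, v) \<in> parcs G)"
      by (simp add: E_def fun_eq_iff)
    have "graph (with_proj G)" "Digraph_Component.connected (with_proj G)"
      using G by (auto simp: clique_tree_def)
    \<comment> \<open>Positivity of \<open>n\<close> comes from connectedness, which excludes the
      empty graph.\<close>
    then have "symp E" "irreflp E" "0 < n"
      using graph_dominates[of "with_proj G"] n
      by (auto simp: E_def Digraph_Component.connected_def strongly_connected_def)
    then have "hoare (\<lambda>R w. R = (\<lambda>_. 0) \<and> w = replicate n True @ False # ws) program
        (program_time n) (\<lambda>R w. R 0 = of_bool (wins E {..<n}))"
      by (rule hoare_program) (simp_all add: ws_def E length_concat_rows nth_concat_rows)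
    then have "answers_within (compile 0 program) (replicate n True @ False # ws) (program_time n)
        (wins E {..<n})"
      by (rule hoare_answers_within) simp
    moreover have "graph_word G = replicate n True @ False # ws"
      by (simp add: graph_word_def n ws_def)
    moreover have "program_time n \<le> poly p (length (graph_word G))"
      unfolding p \<open>graph_word G = _\<close> by (rule poly_nat_mono) simp
    moreover have "first_player_wins (with_proj G) \<longleftrightarrow> wins E {..<n}"
      using first_player_wins_clique_tree[OF G] n by (simp add: E_def)
    ultimately show ?thesis
      using answers_within_mono by simp
  qed
  then show ?thesis
    unfolding poly_time_decidable_on_def by blast
qed

end
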